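(* Let $\Gamma\subseteq\mathbb{R}^n$ be a lattice and $E$ a finite list of elements of $\Gamma$. With indeterminates $p_e,v_e$ ($e\in E$), $$\mathbf{Ehr}_E\bigl(\Gamma;(p_ev_e)_{e\in E}\bigr)=\sum_{A\subseteq E}\Bigl(\prod_{e\in A}p_e\Bigr)\mathbf{Ehr}_A\bigl(\Gamma;(v_e)_{e\in A}\bigr)\,\mathbf{Ehr}_{U_{|E\setminus A|}}\bigl(\mathbb{Z}^{E\setminus A};(-p_e)_{e\in E\setminus A}\bigr).$$ In particular, if $p_e=p$ and $v_e=t$ for all $e$, $$\mathrm{Ehr}_{\mathcal{Z}(E)}(\Gamma;pt)=\sum_{A\subseteq E}p^{|A|}\,\mathrm{Ehr}_{\mathcal{Z}(A)}(\Gamma;t)\,\mathrm{Ehr}_{\square_{|E\setminus A|}}\bigl(\mathbb{Z}^{E\setminus A};-p\bigr).$$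
   Context: For a lattice $\Lambda$ and a finite list $A$ in $\Lambda$, $\mathbf{Ehr}_A(\Lambda;\underline v)=\sum_{B\subseteq A\text{ linearly independent}}|(\Lambda/\langle B\rangle)_{\mathrm{tor}}|\prod_{e\in B}v_e$; for positive integers $k_e$ this equals $|\mathcal{Z}(\underline k\cdot A)\cap\Lambda|$ with $\mathcal{Z}(\underline k\cdot A)=\{\sum_{e\in A}\lambda_ek_ee:0\le\lambda_e\le1\}$. $U_d$ is the standard basis of $\mathbb{R}^d$, so $\mathbf{Ehr}_{U_d}(\mathbb{Z}^d;(x_i))=\prod_{i=1}^d(1+x_i)$. $\mathrm{Ehr}_{\mathcal{Z}(A)}(\Lambda;t)$ is the Ehrhart polynomial of the zonotope $\mathcal{Z}(A)=\{\sum_{e\in A}\lambda_ee:0\le\lambda_e\le1\}$ with respect to $\Lambda$, and $\square_d=[0,1]^d$ is the unit cube, so $\mathrm{Ehr}_{\square_d}(\mathbb{Z}^d;x)=(1+x)^d$. *)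

theory Defs
  imports
    "HOL-Analysis.Analysis"
    "HOL-Library.Poly_Mapping"
    "HOL-Computational_Algebra.Group_Closure"
    "HOL-Computational_Algebra.Polynomial"
begin

text \<open>
  A coordinate space \<open>\<real>\<^sup>I\<close> for a varying finite index set \<open>I\<close> is realised inside the finitely
  supported functions \<open>'i \<Rightarrow>\<^sub>0 real\<close>, as those supported in \<open>I\<close>; hence this instance.
\<close>

instantiation poly_mapping :: (type, real_vector) real_vector
begin

lift_definition scaleR_poly_mapping :: "real \<Rightarrow> ('a \<Rightarrow>\<^sub>0 'b) \<Rightarrow> ('a \<Rightarrow>\<^sub>0 'b)"
  is "\<lambda>r f i. r *\<^sub>R f i"
  by (erule finite_subset[rotated]) auto

instance
  by intro_classes (transfer, simp add: fun_eq_iff algebra_simps)+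

end

definition int_lattice :: "'i set \<Rightarrow> ('i \<Rightarrow>\<^sub>0 real) set" where
  "int_lattice I = {x. Poly_Mapping.keys x \<subseteq> I \<and> (\<forall>i\<in>I. Poly_Mapping.lookup x i \<in> \<int>)}"

definition unit_cube :: "'i set \<Rightarrow> ('i \<Rightarrow>\<^sub>0 real) set" where
  "unit_cube I = {x. Poly_Mapping.keys x \<subseteq> I \<and>
     (\<forall>i\<in>I. 0 \<le> Poly_Mapping.lookup x i \<and> Poly_Mapping.lookup x i \<le> 1)}"

definition std_basis :: "'i \<Rightarrow> ('i \<Rightarrow>\<^sub>0 real)" where
  "std_basis i = Poly_Mapping.single i 1"

text \<open>Lattices are not required to have full rank.\<close>

definition is_lattice :: "'v::real_vector set \<Rightarrow> bool" where
  "is_lattice L \<longleftrightarrow> (\<exists>B. finite B \<and> independent B \<and> L = group_closure B)"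

text \<open>
  The torsion subgroup of \<open>L / H\<close>, as a set of cosets: \<open>x + H\<close> is torsion iff some positive
  multiple of \<open>x\<close> lies in \<open>H\<close>.
\<close>

definition quotient_torsion :: "'v::real_vector set \<Rightarrow> 'v set \<Rightarrow> 'v set set" where
  "quotient_torsion L H =
     {(\<lambda>h. x + h) ` H | x. x \<in> L \<and> (\<exists>m::nat. m > 0 \<and> real m *\<^sub>R x \<in> H)}"

text \<open>
  A finite list of vectors is given by a finite index set \<open>A\<close> and a map \<open>a\<close>, and its sublists by
  the subsets of \<open>A\<close>; entries may repeat, so independence of a sublist includes injectivity.
\<close>

definition independent_family :: "('i \<Rightarrow> 'v::real_vector) \<Rightarrow> 'i set \<Rightarrow> bool" where
  "independent_family a B \<longleftrightarrow> inj_on a B \<and> independent (a ` B)"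

text \<open>
  The multivariate polynomial is represented by its values in arbitrary commutative rings, which
  include polynomial rings and hence the case where the \<open>v i\<close> are indeterminates.
\<close>

definition multi_ehr ::
  "'v::real_vector set \<Rightarrow> 'i set \<Rightarrow> ('i \<Rightarrow> 'v) \<Rightarrow> ('i \<Rightarrow> 'r::comm_ring_1) \<Rightarrow> 'r" where
  "multi_ehr L A a v =
     (\<Sum>B | B \<subseteq> A \<and> independent_family a B.
        of_nat (card (quotient_torsion L (group_closure (a ` B)))) * (\<Prod>i\<in>B. v i))"

definition zonotope :: "'i set \<Rightarrow> ('i \<Rightarrow> 'v::real_vector) \<Rightarrow> 'v set" where
  "zonotope A a = {\<Sum>i\<in>A. c i *\<^sub>R a i | c. \<forall>i\<in>A. 0 \<le> c i \<and> c i \<le> (1::real)}"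

definition is_ehrhart_poly :: "'v::real_vector set \<Rightarrow> 'v set \<Rightarrow> real poly \<Rightarrow> bool" where
  "is_ehrhart_poly L P q \<longleftrightarrow>
     (\<forall>k::nat. k > 0 \<longrightarrow> poly q (real k) = real (card ((\<lambda>x. real k *\<^sub>R x) ` P \<inter> L)))"

definition ehrhart_poly :: "'v::real_vector set \<Rightarrow> 'v set \<Rightarrow> real poly" where
  "ehrhart_poly L P = (THE q. is_ehrhart_poly L P q)"

lemma is_ehrhart_poly_unique:
  assumes "is_ehrhart_poly L P q" "is_ehrhart_poly L P r"
  shows "q = r"
proof (rule ccontr)
  assume "q \<noteq> r"
  then have "finite {x. poly (q - r) x = 0}"
    by (intro poly_roots_finite) simp
  moreover have "real ` {0<..} \<subseteq> {x. poly (q - r) x = 0}"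
    using assms by (auto simp: is_ehrhart_poly_def)
  ultimately have "finite (real ` {0<..})"
    by (rule finite_subset[rotated])
  then have "finite {0::nat<..}"
    by (rule finite_imageD) (simp add: inj_on_def)
  then show False
    using infinite_Ioi by blast
qed

lemma ehrhart_poly_eqI: "is_ehrhart_poly L P q \<Longrightarrow> ehrhart_poly L P = q"
  unfolding ehrhart_poly_def by (blast intro: the_equality is_ehrhart_poly_unique)

end

theory Submission
  imports Defs
begin

text \<open>
  The multivariate identity is a double count: after exchanging the sums, the coefficient of an
  independent \<open>B\<close> is \<open>\<Sum>A\<supseteq>B. \<Prod>A p * \<Prod>(E - A) (1 - p)\<close>, which collapses to \<open>\<Prod>B p\<close> because
  \<open>p + (1 - p) = 1\<close>.

  Specialising it requires Stanley's formula for the lattice points of a zonotope. Adding a vector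
  \<open>e \<noteq> 0\<close> to a zonotope lengthens every fibre of the projection along \<open>e\<close> by a half-open
  segment of length \<open>e\<close>, and over each projected lattice point such a segment contains as many
  lattice points as \<open>(0, e]\<close>. Half-open parallelepipeds spanned by independent subfamilies obey the
  same deletion-contraction recursion, so the two counts agree. A half-open parallelepiped is a
  transversal of the torsion of the quotient, and dilation by \<open>k\<close> cuts it into
  \<open>k ^ card B\<close> translates.
\<close>

subsection \<open>Independent families and generated subgroups\<close>

text \<open>A repetition \<open>a i = a j\<close> is itself a linear relation, with coefficients 1
  and -1. Hence the injectivity demanded of an independent family is absorbed into one condition on
  coefficients indexed by \<open>B\<close>.\<close>

lemma independent_family_iff:
  assumes "finite B"
  shows "independent_family a B \<longleftrightarrow>
    (\<forall>u. (\<Sum>i\<in>B. u i *\<^sub>R a i) = 0 \<longrightarrow> (\<forall>i\<in>B. u i = 0))"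
proof
  assume "independent_family a B"
  then have inj: "inj_on a B" and ind: "independent (a ` B)"
    by (auto simp: independent_family_def)
  show "\<forall>u. (\<Sum>i\<in>B. u i *\<^sub>R a i) = 0 \<longrightarrow> (\<forall>i\<in>B. u i = 0)"
  proof (intro allI impI ballI)
    fix u i assume u: "(\<Sum>i\<in>B. u i *\<^sub>R a i) = 0" and i: "i \<in> B"
    have "(\<Sum>x\<in>a ` B. u (the_inv_into B a x) *\<^sub>R x) = (\<Sum>i\<in>B. u i *\<^sub>R a i)"
      using inj by (simp add: sum.reindex the_inv_into_f_f)
    with u ind assms i have "u (the_inv_into B a (a i)) = 0"
      by (subst (asm) dependent_finite) auto
    then show "u i = 0"
      using inj i by (simp add: the_inv_into_f_f)
  qed
next
  assume *: "\<forall>u. (\<Sum>i\<in>B. u i *\<^sub>R a i) = 0 \<longrightarrow> (\<forall>i\<in>B. u i = 0)"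
  have inj: "inj_on a B"
  proof (rule inj_onI, rule ccontr)
    fix i j assume ij: "i \<in> B" "j \<in> B" "a i = a j" "i \<noteq> j"
    let ?u = "\<lambda>k. (if k = i then 1 else 0) - (if k = j then 1 else 0 :: real)"
    have "(\<Sum>k\<in>B. ?u k *\<^sub>R a k) =
        (\<Sum>k\<in>B. if k = i then a k else 0) - (\<Sum>k\<in>B. if k = j then a k else 0)"
      unfolding sum_subtractf[symmetric] by (rule sum.cong) (auto simp: algebra_simps)
    also have "\<dots> = 0"
      using ij assms by simp
    finally show False
      using *[rule_format, of ?u i] ij by simp
  qed
  moreover have "independent (a ` B)"
  proof
    assume "dependent (a ` B)"
    then obtain u x where "x \<in> a ` B" "u x \<noteq> 0" "(\<Sum>x\<in>a ` B. u x *\<^sub>R x) = 0"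
      using assms by (subst (asm) dependent_finite) auto
    with * inj show False
      by (auto simp: sum.reindex)
  qed
  ultimately show "independent_family a B"
    by (simp add: independent_family_def)
qed

text \<open>Zero and differences are the closure properties shared by \<open>group_closure\<close>
  and \<open>discrete_group\<close>; this form serves both.\<close>

lemma sum_closed_diff:
  fixes G :: "'v::ab_group_add set"
  assumes "0 \<in> G" "\<And>x y. x \<in> G \<Longrightarrow> y \<in> G \<Longrightarrow> x - y \<in> G" "\<And>i. i \<in> I \<Longrightarrow> f i \<in> G"
  shows "sum f I \<in> G"
proof -
  have "x + y \<in> G" if "x \<in> G" "y \<in> G" for x y
    using assms(2)[OF that(1) assms(2)[OF assms(1) that(2)]] by simp
  with assms(1,3) show ?thesis
    by (induction I rule: infinite_finite_induct) auto
qed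

lemma of_int_scaleR_closed_diff:
  fixes G :: "'v::real_vector set"
  assumes "0 \<in> G" "\<And>x y. x \<in> G \<Longrightarrow> y \<in> G \<Longrightarrow> x - y \<in> G" "x \<in> G"
  shows "of_int n *\<^sub>R x \<in> G"
proof -
  have nat: "of_nat m *\<^sub>R x \<in> G" for m
    using sum_closed_diff[OF assms(1,2), of "{..<m}" "\<lambda>_. x"] assms(3)
    by (simp add: scaleR_conv_of_real sum_constant_scaleR)
  show ?thesis
  proof (cases n)
    case (nonneg m)
    with nat[of m] show ?thesis by simp
  next
    case (neg m)
    then have "of_int n *\<^sub>R x = 0 - of_nat (Suc m) *\<^sub>R x"
      by (simp only: of_int_minus of_int_of_nat_eq scaleR_minus_left diff_0)
    with assms(2)[OF assms(1) nat[of "Suc m"]] show ?thesis by (simp only:)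
  qed
qed

lemma group_closure_subset:
  assumes "0 \<in> G" "\<And>x y. x \<in> G \<Longrightarrow> y \<in> G \<Longrightarrow> x - y \<in> G" "S \<subseteq> G"
  shows "group_closure S \<subseteq> G"
proof
  fix x assume "x \<in> group_closure S"
  then show "x \<in> G"
    by induction (use assms in auto)
qed

text \<open>The integer combinations form a subgroup containing the generators, and any subgroup
  containing the generators contains them all.\<close>

lemma group_closure_image_eq:
  fixes a :: "'i \<Rightarrow> 'v::real_vector"
  assumes "finite B"
  shows "group_closure (a ` B) = range (\<lambda>n. \<Sum>i\<in>B. of_int (n i) *\<^sub>R a i)"
proof
  show "group_closure (a ` B) \<subseteq> range (\<lambda>n. \<Sum>i\<in>B. of_int (n i) *\<^sub>R a i)" (is "_ \<subseteq> ?R")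
  proof (rule group_closure_subset)
    show "0 \<in> ?R"
      by (rule range_eqI[of _ _ "\<lambda>_. 0"]) simp
    fix x y assume "x \<in> ?R" "y \<in> ?R"
    then obtain m n where "x = (\<Sum>i\<in>B. of_int (m i) *\<^sub>R a i)" "y = (\<Sum>i\<in>B. of_int (n i) *\<^sub>R a i)"
      by auto
    then have "x - y = (\<Sum>i\<in>B. of_int (m i - n i) *\<^sub>R a i)"
      by (simp add: sum_subtractf algebra_simps)
    then show "x - y \<in> ?R" by (rule range_eqI[where x = "\<lambda>i. m i - n i"])
  next
    show "a ` B \<subseteq> ?R"
    proof clarify
      fix j assume "j \<in> B"
      then have "a j = (\<Sum>i\<in>B. of_int (if i = j then 1 else 0) *\<^sub>R a i)"
        using assms by (simp add: if_distrib if_distribR cong: if_cong)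
      then show "a j \<in> ?R" by (rule range_eqI[where x = "\<lambda>i. if i = j then 1 else 0"])
    qed
  qed
  show "range (\<lambda>n. \<Sum>i\<in>B. of_int (n i) *\<^sub>R a i) \<subseteq> group_closure (a ` B)"
    by (auto intro!: sum_closed_diff of_int_scaleR_closed_diff group_closure.diff
        intro: group_closure.base)
qed

lemma coset_group_closure_eq_iff:
  "(+) x ` group_closure S = (+) y ` group_closure S \<longleftrightarrow> x - y \<in> group_closure S"
proof
  assume *: "(+) x ` group_closure S = (+) y ` group_closure S"
  have "x \<in> (+) x ` group_closure S"
    by (rule image_eqI[of _ _ 0]) auto
  then show "x - y \<in> group_closure S"
    unfolding * by auto
next
  have "(+) x ` group_closure S \<subseteq> (+) y ` group_closure S" if "x - y \<in> group_closure S" for x y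
  proof
    fix z assume "z \<in> (+) x ` group_closure S"
    then obtain h where "h \<in> group_closure S" "z = x + h" by auto
    with that show "z \<in> (+) y ` group_closure S"
      by (intro image_eqI[of _ _ "(x - y) + h"] group_closure_add) auto
  qed
  moreover assume "x - y \<in> group_closure S"
  moreover from this have "y - x \<in> group_closure S"
    by (metis group_closure_minus_iff minus_diff_eq)
  ultimately show "(+) x ` group_closure S = (+) y ` group_closure S"
    by (intro equalityI) auto
qed

subsection \<open>The unit cube and the multivariate identity\<close>

lemma lookup_scaleR: "Poly_Mapping.lookup (r *\<^sub>R x) i = r *\<^sub>R Poly_Mapping.lookup x i"
  by transfer simp

lemma lookup_sum_std_basis:
  assumes "finite B"
  shows "Poly_Mapping.lookup (\<Sum>i\<in>B. u i *\<^sub>R std_basis i) j = (if j \<in> B then u j else 0)"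
  using assms
  by (simp add: lookup_sum lookup_scaleR std_basis_def lookup_single when_def if_distrib
      cong: if_cong)

lemma independent_family_std_basis:
  assumes "finite B"
  shows "independent_family std_basis B"
  unfolding independent_family_iff[OF assms]
proof (intro allI impI ballI)
  fix u i assume "(\<Sum>i\<in>B. u i *\<^sub>R std_basis i) = 0" "i \<in> B"
  then show "u i = 0"
    using lookup_sum_std_basis[OF assms, of u i] by simp
qed

text \<open>If a positive multiple of a lattice point \<open>x\<close> lies in the span of
  \<open>B\<close>, then \<open>x\<close> vanishes outside \<open>B\<close> and has integer
  coordinates on \<open>B\<close>. So \<open>x\<close> is already in the subgroup, and only the
  trivial torsion class remains.\<close>

lemma quotient_torsion_std_basis:
  assumes "finite I" "B \<subseteq> I"
  shows "quotient_torsion (int_lattice I) (group_closure (std_basis ` B)) =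
    {group_closure (std_basis ` B)}"
proof -
  let ?H = "group_closure (std_basis ` B) :: ('a \<Rightarrow>\<^sub>0 real) set"
  have fin: "finite B"
    using assms finite_subset by blast
  have coset: "(+) x ` ?H = ?H" if x: "x \<in> ?H" for x
    using x coset_group_closure_eq_iff[of x "std_basis ` B" 0] by simp
  have mem: "x \<in> ?H" if x: "x \<in> int_lattice I" and m: "m > 0" "real m *\<^sub>R x \<in> ?H" for x m
  proof -
    obtain n where n: "real m *\<^sub>R x = (\<Sum>i\<in>B. of_int (n i) *\<^sub>R std_basis i)"
      using m(2) unfolding group_closure_image_eq[OF fin] by blast
    \<comment> \<open>The floor only supplies integer-typed coefficients: on \<open>B\<close> the
      coordinates of \<open>x\<close> are integers already.\<close>
    have "x = (\<Sum>i\<in>B. of_int \<lfloor>Poly_Mapping.lookup x i\<rfloor> *\<^sub>R std_basis i)"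
    proof (rule poly_mapping_eqI)
      fix j
      have "real m * Poly_Mapping.lookup x j = (if j \<in> B then of_int (n j) else 0)"
        using arg_cong[OF n, of "\<lambda>y. Poly_Mapping.lookup y j"]
        by (simp add: lookup_scaleR lookup_sum_std_basis[OF fin])
      moreover have "Poly_Mapping.lookup x j \<in> \<int>" if "j \<in> B"
        using x assms(2) that by (auto simp: int_lattice_def)
      ultimately show "Poly_Mapping.lookup x j = Poly_Mapping.lookup
          (\<Sum>i\<in>B. of_int \<lfloor>Poly_Mapping.lookup x i\<rfloor> *\<^sub>R std_basis i) j"
        using m(1) by (auto simp: lookup_sum_std_basis[OF fin])
    qed
    then show ?thesis
      unfolding group_closure_image_eq[OF fin]
      by (rule range_eqI[where x = "\<lambda>i. \<lfloor>Poly_Mapping.lookup x i\<rfloor>"])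
  qed
  have "?H = (+) 0 ` ?H \<and> 0 \<in> int_lattice I \<and> (\<exists>m::nat. m > 0 \<and> real m *\<^sub>R 0 \<in> ?H)"
    by (auto simp: int_lattice_def)
  then have "?H \<in> quotient_torsion (int_lattice I) ?H"
    unfolding quotient_torsion_def by blast
  moreover have "quotient_torsion (int_lattice I) ?H \<subseteq> {?H}"
  proof
    fix T assume "T \<in> quotient_torsion (int_lattice I) ?H"
    then obtain x and m :: nat where "T = (+) x ` ?H" "x \<in> int_lattice I" "m > 0" "real m *\<^sub>R x \<in> ?H"
      unfolding quotient_torsion_def by blast
    then show "T \<in> {?H}"
      using coset[OF mem] by blast
  qed
  ultimately show ?thesis by blast
qed

text \<open>Every subset of a standard basis is independent and has torsion number 1, so the
  defining sum is the expansion of a product over subsets.\<close>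

lemma multi_ehr_std_basis:
  assumes "finite I"
  shows "multi_ehr (int_lattice I) I std_basis x = (\<Prod>i\<in>I. 1 + x i)"
proof -
  have "{B. B \<subseteq> I \<and> independent_family (std_basis :: 'a \<Rightarrow> _) B} = Pow I"
    using assms finite_subset by (auto intro: independent_family_std_basis)
  then have "multi_ehr (int_lattice I) I std_basis x = (\<Sum>B\<in>Pow I. \<Prod>i\<in>B. x i)"
    unfolding multi_ehr_def
    by (auto intro!: sum.cong simp: quotient_torsion_std_basis[OF assms])
  also have "\<dots> = (\<Prod>i\<in>I. x i + 1)"
    by (simp add: prod_add[OF assms])
  finally show ?thesis by (simp add: add.commute)
qed

text \<open>Writing \<open>A = B \<union> C\<close> with \<open>C \<subseteq> I - B\<close> factors
  out the product over \<open>B\<close>; the sum over \<open>C\<close> expands a product of factors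
  \<open>p i + (1 - p i)\<close>.\<close>

lemma sum_supersets_prod_complement:
  fixes p :: "'i \<Rightarrow> 'r::comm_ring_1"
  assumes "finite I" "B \<subseteq> I"
  shows "(\<Sum>A | A \<subseteq> I \<and> B \<subseteq> A. (\<Prod>i\<in>A. p i) * (\<Prod>i\<in>I - A. 1 - p i)) = (\<Prod>i\<in>B. p i)"
proof -
  have fin: "finite B"
    using assms finite_subset by blast
  have "(\<Sum>A | A \<subseteq> I \<and> B \<subseteq> A. (\<Prod>i\<in>A. p i) * (\<Prod>i\<in>I - A. 1 - p i)) =
      (\<Sum>C\<in>Pow (I - B). (\<Prod>i\<in>B. p i) * ((\<Prod>i\<in>C. p i) * (\<Prod>i\<in>I - B - C. 1 - p i)))"
  proof (rule sum.reindex_bij_witness[of _ "\<lambda>C. B \<union> C" "\<lambda>A. A - B"])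
    fix A assume A: "A \<in> {A. A \<subseteq> I \<and> B \<subseteq> A}"
    then have "finite A"
      using assms(1) finite_subset by blast
    with A have "(\<Prod>i\<in>A. p i) = (\<Prod>i\<in>B. p i) * (\<Prod>i\<in>A - B. p i)"
      by (subst mult.commute) (simp add: prod.subset_diff)
    moreover have "I - B - (A - B) = I - A"
      using A by auto
    ultimately show "(\<Prod>i\<in>B. p i) * ((\<Prod>i\<in>A - B. p i) * (\<Prod>i\<in>I - B - (A - B). 1 - p i)) =
        (\<Prod>i\<in>A. p i) * (\<Prod>i\<in>I - A. 1 - p i)"
      by (simp add: mult.assoc)
  qed (use assms in auto)
  also have "\<dots> = (\<Prod>i\<in>B. p i) * (\<Prod>i\<in>I - B. p i + (1 - p i))"
    unfolding sum_distrib_left[symmetric] by (subst prod_add) (use assms in auto)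
  finally show ?thesis by simp
qed

theorem multi_ehr_mult:
  fixes p v :: "'i \<Rightarrow> 'r::comm_ring_1"
  assumes "finite I"
  shows "multi_ehr L I a (\<lambda>i. p i * v i) =
    (\<Sum>A\<in>Pow I. (\<Prod>i\<in>A. p i) * multi_ehr L A a v *
      multi_ehr (int_lattice (I - A)) (I - A) std_basis (\<lambda>i. - p i))"
proof -
  \<comment> \<open>\<open>g B\<close> is the term of \<open>B\<close> in the unscaled polynomial;
    \<open>Q A\<close> combines the weight of \<open>A\<close> with the cube factor of its
    complement.\<close>
  define g where
    "g B = (of_nat (card (quotient_torsion L (group_closure (a ` B)))) * (\<Prod>i\<in>B. v i) :: 'r)" for B
  define Q where "Q A = (\<Prod>i\<in>A. p i) * (\<Prod>i\<in>I - A. 1 - p i)" for A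
  have "(\<Sum>A\<in>Pow I. (\<Prod>i\<in>A. p i) * multi_ehr L A a v *
      multi_ehr (int_lattice (I - A)) (I - A) std_basis (\<lambda>i. - p i)) =
      (\<Sum>A\<in>Pow I. \<Sum>B | B \<in> {B. B \<subseteq> I \<and> independent_family a B} \<and> B \<subseteq> A. g B * Q A)"
  proof (rule sum.cong)
    fix A assume A: "A \<in> Pow I"
    have "multi_ehr (int_lattice (I - A)) (I - A) std_basis (\<lambda>i. - p i) = (\<Prod>i\<in>I - A. 1 - p i)"
      using assms by (simp add: multi_ehr_std_basis)
    moreover have "{B. B \<subseteq> A \<and> independent_family a B} =
        {B. B \<in> {B. B \<subseteq> I \<and> independent_family a B} \<and> B \<subseteq> A}"
      using A by auto
    ultimately show "(\<Prod>i\<in>A. p i) * multi_ehr L A a v *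
      multi_ehr (int_lattice (I - A)) (I - A) std_basis (\<lambda>i. - p i) =
      (\<Sum>B | B \<in> {B. B \<subseteq> I \<and> independent_family a B} \<and> B \<subseteq> A. g B * Q A)"
      by (simp add: multi_ehr_def[of L] g_def Q_def sum_distrib_left sum_distrib_right mult_ac)
  qed simp
  also have "\<dots> = (\<Sum>B | B \<subseteq> I \<and> independent_family a B. \<Sum>A | A \<in> Pow I \<and> B \<subseteq> A. g B * Q A)"
    using assms by (intro sum.swap_restrict) auto
  also have "\<dots> = (\<Sum>B | B \<subseteq> I \<and> independent_family a B. g B * (\<Prod>i\<in>B. p i))"
    using sum_supersets_prod_complement[OF assms, of _ p]
    by (intro sum.cong) (auto simp: sum_distrib_left[symmetric] Q_def)
  also have "\<dots> = multi_ehr L I a (\<lambda>i. p i * v i)"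
    by (simp add: multi_ehr_def g_def prod.distrib mult_ac)
  finally show ?thesis by simp
qed

text \<open>Lattice points of the \<open>k\<close>-fold cube are the functions from \<open>I\<close>
  to \<open>{..k}\<close>, with \<open>k + 1\<close> choices per coordinate.\<close>

lemma is_ehrhart_poly_unit_cube:
  assumes "finite I"
  shows "is_ehrhart_poly (int_lattice I) (unit_cube I) ([:1, 1:] ^ card I)"
  unfolding is_ehrhart_poly_def
proof (intro allI impI)
  fix k :: nat assume k: "k > 0"
  define F where "F n = (\<Sum>i\<in>I. real (n i) *\<^sub>R std_basis i)" for n :: "'a \<Rightarrow> nat"
  have F: "Poly_Mapping.lookup (F n) j = (if j \<in> I then real (n j) else 0)" for n j
    unfolding F_def by (rule lookup_sum_std_basis[OF assms])
  have "bij_betw F (I \<rightarrow>\<^sub>E {..k}) ((\<lambda>x. real k *\<^sub>R x) ` unit_cube I \<inter> int_lattice I)"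
    unfolding bij_betw_def
  proof
    show "inj_on F (I \<rightarrow>\<^sub>E {..k})"
    proof (rule inj_onI, rule PiE_ext)
      fix m n j assume "F m = F n" "j \<in> I"
      then show "m j = n j"
        using F[of m j] F[of n j] by simp
    qed auto
    show "F ` (I \<rightarrow>\<^sub>E {..k}) = (\<lambda>x. real k *\<^sub>R x) ` unit_cube I \<inter> int_lattice I"
    proof (intro equalityI subsetI)
      fix y assume "y \<in> F ` (I \<rightarrow>\<^sub>E {..k})"
      then obtain n where n: "n \<in> I \<rightarrow>\<^sub>E {..k}" "y = F n" by auto
      then have "(1 / real k) *\<^sub>R y \<in> unit_cube I"
        using k by (auto simp: unit_cube_def lookup_scaleR F in_keys_iff PiE_iff split: if_splits)
      moreover have "y = real k *\<^sub>R ((1 / real k) *\<^sub>R y)"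
        using k by simp
      moreover have "y \<in> int_lattice I"
        using n by (auto simp: int_lattice_def F in_keys_iff split: if_splits)
      ultimately show "y \<in> (\<lambda>x. real k *\<^sub>R x) ` unit_cube I \<inter> int_lattice I" by blast
    next
      fix y assume "y \<in> (\<lambda>x. real k *\<^sub>R x) ` unit_cube I \<inter> int_lattice I"
      then obtain x where x: "x \<in> unit_cube I" "y = real k *\<^sub>R x" and y: "y \<in> int_lattice I"
        by auto
      \<comment> \<open>The coordinates of \<open>y\<close> are nonnegative integers, so
        \<open>nat\<close> and the floor lose nothing; \<open>restrict\<close> makes the function
        extensional.\<close>
      define n where "n = restrict (\<lambda>i. nat \<lfloor>Poly_Mapping.lookup y i\<rfloor>) I"
      have ub: "0 \<le> Poly_Mapping.lookup y i" "Poly_Mapping.lookup y i \<le> real k" if "i \<in> I" for i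
        using x that k by (auto simp: unit_cube_def lookup_scaleR mult_left_le)
      have eq: "real (n i) = Poly_Mapping.lookup y i" if "i \<in> I" for i
        using y ub(1)[OF that] that by (auto simp: n_def int_lattice_def elim!: Ints_cases)
      have "n \<in> I \<rightarrow>\<^sub>E {..k}"
        using ub(2) eq by (auto simp: n_def simp flip: of_nat_le_iff[where 'a = real])
      moreover have "y = F n"
        using y by (intro poly_mapping_eqI) (auto simp: F eq int_lattice_def in_keys_iff)
      ultimately show "y \<in> F ` (I \<rightarrow>\<^sub>E {..k})" by blast
    qed
  qed
  then have "card ((\<lambda>x. real k *\<^sub>R x) ` unit_cube I \<inter> int_lattice I) = card (I \<rightarrow>\<^sub>E {..k})"
    using bij_betw_same_card by metis
  also have "\<dots> = Suc k ^ card I"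
    using assms by (simp add: card_PiE)
  finally show "poly ([:1, 1:] ^ card I) (real k) =
      real (card ((\<lambda>x. real k *\<^sub>R x) ` unit_cube I \<inter> int_lattice I))"
    by (simp add: add.commute)
qed

subsection \<open>Discrete subgroups\<close>

text \<open>The representative modulo 1 in \<open>(0, 1]\<close>. The interval is half-open on this side because adding a
  segment to a zonotope adds, on each line parallel to it, an interval open below and closed above.\<close>

definition upper_frac :: "real \<Rightarrow> real" where
  "upper_frac r = r - of_int (\<lceil>r\<rceil> - 1)"

lemma upper_frac_bounds: "upper_frac r \<in> {0<..1}"
  unfolding upper_frac_def by (auto; linarith)

lemma upper_frac_add_of_int [simp]: "upper_frac (r + of_int n) = upper_frac r"
  by (simp add: upper_frac_def)

lemma upper_frac_eq_self: "r \<in> {0<..1} \<Longrightarrow> upper_frac r = r"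
  by (simp add: upper_frac_def ceiling_eq_iff[of _ 1, simplified] ceiling_unique[of 1])

text \<open>Discreteness is phrased through bounded sets instead of a basis because this passes
  directly to the projection of the group along one of its vectors.\<close>

definition discrete_group :: "'v::euclidean_space set \<Rightarrow> bool" where
  "discrete_group G \<longleftrightarrow> 0 \<in> G \<and> (\<forall>x\<in>G. \<forall>y\<in>G. x - y \<in> G) \<and> (\<forall>S. bounded S \<longrightarrow> finite (G \<inter> S))"

context
  fixes G :: "'v::euclidean_space set"
  assumes G: "discrete_group G"
begin

lemma discrete_group_zero: "0 \<in> G"
  and discrete_group_diff: "x \<in> G \<Longrightarrow> y \<in> G \<Longrightarrow> x - y \<in> G"
  and discrete_group_finite_Int: "bounded S \<Longrightarrow> finite (G \<inter> S)"
  using G by (auto simp: discrete_group_def)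

lemma discrete_group_add: "x \<in> G \<Longrightarrow> y \<in> G \<Longrightarrow> x + y \<in> G"
  using discrete_group_diff[OF _ discrete_group_diff[OF discrete_group_zero], of x y] by simp

lemma discrete_group_sum: "(\<And>i. i \<in> I \<Longrightarrow> f i \<in> G) \<Longrightarrow> sum f I \<in> G"
  by (rule sum_closed_diff[OF discrete_group_zero discrete_group_diff])

lemma discrete_group_scaleR: "x \<in> G \<Longrightarrow> of_int n *\<^sub>R x \<in> G"
  by (rule of_int_scaleR_closed_diff[OF discrete_group_zero discrete_group_diff])

lemma discrete_group_shift_iff:
  assumes "y \<in> G"
  shows "x + y \<in> G \<longleftrightarrow> x \<in> G"
  using discrete_group_add[OF _ assms] discrete_group_diff[OF _ assms] by (metis add_diff_cancel)

text \<open>The parameters \<open>s\<close> with \<open>x + s *\<^sub>R e \<in> G\<close> form a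
  translate by \<open>t\<close> of those with \<open>s *\<^sub>R e \<in> G\<close>. The latter set
  is invariant under integer shifts since \<open>e \<in> G\<close>, so all half-open unit intervals
  meet it equally often.\<close>

lemma card_unit_interval_line:
  assumes e: "e \<in> G" and t: "x + t *\<^sub>R e \<in> G"
  shows "card {s \<in> {h<..h+1}. x + s *\<^sub>R e \<in> G} = card {s \<in> {0<..1}. s *\<^sub>R e \<in> G}"
proof -
  have shift: "x + (s + of_int n) *\<^sub>R e \<in> G \<longleftrightarrow> x + s *\<^sub>R e \<in> G" for x s n
    using discrete_group_shift_iff[OF discrete_group_scaleR[OF e, of n], of "x + s *\<^sub>R e"]
    by (simp add: algebra_simps)
  have trans: "x + (s + t) *\<^sub>R e \<in> G \<longleftrightarrow> s *\<^sub>R e \<in> G" for s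
    using discrete_group_shift_iff[OF t, of "s *\<^sub>R e"] by (simp add: algebra_simps)
  have uf: "upper_frac s = s + of_int (1 - \<lceil>s\<rceil>)" for s
    by (simp add: upper_frac_def)
  have mem: "upper_frac s *\<^sub>R e \<in> G \<longleftrightarrow> s *\<^sub>R e \<in> G" for s
    using shift[of 0 s "1 - \<lceil>s\<rceil>"] by (simp add: uf)
  have "bij_betw (\<lambda>s. upper_frac (s - t)) {s \<in> {h<..h+1}. x + s *\<^sub>R e \<in> G}
      {s \<in> {0<..1}. s *\<^sub>R e \<in> G}"
  \<comment> \<open>One map undoes the translation by \<open>t\<close> and reduces modulo 1 into
    \<open>{0<..1}\<close>; the other restores \<open>t\<close> and reduces modulo 1 into
    \<open>{h<..h+1}\<close>.\<close>
  proof (rule bij_betw_byWitness[where f' = "\<lambda>r. h + upper_frac (r + t - h)"])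
    show "\<forall>s\<in>{s \<in> {h<..h+1}. x + s *\<^sub>R e \<in> G}. h + upper_frac (upper_frac (s - t) + t - h) = s"
    proof
      fix s assume s: "s \<in> {s \<in> {h<..h+1}. x + s *\<^sub>R e \<in> G}"
      have "upper_frac (s - t) + t - h = (s - h) + of_int (1 - \<lceil>s - t\<rceil>)"
        by (simp add: uf)
      then have "upper_frac (upper_frac (s - t) + t - h) = upper_frac (s - h)"
        by (simp only: upper_frac_add_of_int)
      also have "\<dots> = s - h"
        using s by (intro upper_frac_eq_self) auto
      finally show "h + upper_frac (upper_frac (s - t) + t - h) = s" by simp
    qed
    show "\<forall>r\<in>{s \<in> {0<..1}. s *\<^sub>R e \<in> G}. upper_frac (h + upper_frac (r + t - h) - t) = r"
    proof
      fix r assume r: "r \<in> {s \<in> {0<..1}. s *\<^sub>R e \<in> G}"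
      have "h + upper_frac (r + t - h) - t = r + of_int (1 - \<lceil>r + t - h\<rceil>)"
        by (simp add: uf)
      then have "upper_frac (h + upper_frac (r + t - h) - t) = upper_frac r"
        by (simp only: upper_frac_add_of_int)
      with r show "upper_frac (h + upper_frac (r + t - h) - t) = r"
        by (simp add: upper_frac_eq_self)
    qed
    show "(\<lambda>s. upper_frac (s - t)) ` {s \<in> {h<..h+1}. x + s *\<^sub>R e \<in> G} \<subseteq>
        {s \<in> {0<..1}. s *\<^sub>R e \<in> G}"
    proof clarify
      fix s assume "x + s *\<^sub>R e \<in> G"
      with trans[of "s - t"] show "upper_frac (s - t) \<in> {0<..1} \<and> upper_frac (s - t) *\<^sub>R e \<in> G"
        using upper_frac_bounds by (simp add: mem)
    qed
    show "(\<lambda>r. h + upper_frac (r + t - h)) ` {s \<in> {0<..1}. s *\<^sub>R e \<in> G} \<subseteq>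
        {s \<in> {h<..h+1}. x + s *\<^sub>R e \<in> G}"
    proof clarify
      fix r assume r: "r *\<^sub>R e \<in> G"
      have "h + upper_frac (r + t - h) = (r + t) + of_int (1 - \<lceil>r + t - h\<rceil>)"
        by (simp add: uf)
      then have "x + (h + upper_frac (r + t - h)) *\<^sub>R e \<in> G \<longleftrightarrow> x + (r + t) *\<^sub>R e \<in> G"
        by (simp only: shift)
      with r trans show "h + upper_frac (r + t - h) \<in> {h<..h+1} \<and>
          x + (h + upper_frac (r + t - h)) *\<^sub>R e \<in> G"
        using upper_frac_bounds[of "r + t - h"] by simp
    qed
  qed
  then show ?thesis by (rule bij_betw_same_card)
qed

end

text \<open>Coordinate functionals of a basis are bounded on bounded sets, so only finitely many
  integer coordinate vectors can occur there.\<close>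

lemma is_lattice_discrete_group:
  fixes L :: "'v::euclidean_space set"
  assumes "is_lattice L"
  shows "discrete_group L"
proof -
  obtain B where B: "finite B" "independent B" "L = group_closure B"
    using assms by (auto simp: is_lattice_def)
  have "finite (L \<inter> S)" if S: "bounded S" for S
  proof -
    have "\<exists>K. \<forall>n::'v \<Rightarrow> int. (\<Sum>c\<in>B. of_int (n c) *\<^sub>R c) \<in> S \<longrightarrow> \<bar>n b\<bar> \<le> K" if b: "b \<in> B" for b
    proof -
      \<comment> \<open>The coordinate functional of \<open>b\<close>, extended from
        \<open>B\<close> to the whole space; in finite dimension it is a bounded linear map.\<close>
      obtain f :: "'v \<Rightarrow> real" where f: "linear f" "\<forall>c\<in>B. f c = (if c = b then 1 else 0)"
        using linear_independent_extend[OF B(2), of "\<lambda>c. if c = b then 1 else 0"] by blast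
      have "bounded (f ` S)"
        using S f(1) by (simp add: bounded_linear_image linear_conv_bounded_linear)
      then obtain K where K: "\<And>x. x \<in> S \<Longrightarrow> \<bar>f x\<bar> \<le> K"
        by (auto simp: bounded_iff)
      have "\<bar>n b\<bar> \<le> \<lfloor>K\<rfloor>" if "(\<Sum>c\<in>B. of_int (n c) *\<^sub>R c) \<in> S" for n :: "'v \<Rightarrow> int"
      proof -
        have "f (\<Sum>c\<in>B. of_int (n c) *\<^sub>R c) = (\<Sum>c\<in>B. of_int (n c) * f c)"
          by (simp add: linear_sum[OF f(1)] linear_scale[OF f(1)])
        also have "\<dots> = (\<Sum>c\<in>B. if c = b then of_int (n c) else 0)"
          using f(2) by (intro sum.cong) auto
        also have "\<dots> = of_int (n b)"
          using b B(1) by simp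
        finally show ?thesis
          using K[OF that] by (simp add: le_floor_iff)
      qed
      then show ?thesis by blast
    qed
    then obtain K where K: "\<And>n b. b \<in> B \<Longrightarrow> (\<Sum>c\<in>B. of_int (n c) *\<^sub>R c) \<in> S \<Longrightarrow> \<bar>n b\<bar> \<le> K b"
      by metis
    have "L \<inter> S \<subseteq> (\<lambda>n. \<Sum>c\<in>B. of_int (n c) *\<^sub>R c) ` (\<Pi>\<^sub>E b\<in>B. {- K b..K b})"
    proof
      fix x assume x: "x \<in> L \<inter> S"
      then obtain n where n: "x = (\<Sum>c\<in>B. of_int (n c) *\<^sub>R c)"
        using group_closure_image_eq[OF B(1), of id] B(3) by auto
      \<comment> \<open>Values of \<open>n\<close> outside \<open>B\<close> are arbitrary;
        restricting places the coefficients in a finite function space without changing the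
        sum.\<close>
      have "restrict n B \<in> (\<Pi>\<^sub>E b\<in>B. {- K b..K b})"
        using K[of _ n] x n by (force simp: abs_le_iff)
      moreover have "x = (\<Sum>c\<in>B. of_int (restrict n B c) *\<^sub>R c)"
        unfolding n by (intro sum.cong) auto
      ultimately show "x \<in> (\<lambda>n. \<Sum>c\<in>B. of_int (n c) *\<^sub>R c) ` (\<Pi>\<^sub>E b\<in>B. {- K b..K b})"
        by (intro image_eqI[where x = "restrict n B"])
    qed
    moreover have "finite \<dots>"
      using B(1) by (intro finite_imageI finite_PiE) auto
    ultimately show ?thesis
      by (rule finite_subset)
  qed
  then show ?thesis
    by (auto simp: discrete_group_def B(3) intro: group_closure.diff)
qed

subsection \<open>Zonotopes\<close>

lemma zonotope_empty [simp]: "zonotope {} a = {0}"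
  by (simp add: zonotope_def)

text \<open>The Minkowski-sum form yields compactness and convexity by induction, and later
  describes the growth of a zonotope along one vector.\<close>

lemma zonotope_insert:
  assumes "finite A" "j \<notin> A"
  shows "zonotope (insert j A) a = {x + y | x y. x \<in> zonotope A a \<and> y \<in> (\<lambda>s. s *\<^sub>R a j) ` {0..1}}"
proof (intro equalityI subsetI)
  fix z assume "z \<in> zonotope (insert j A) a"
  then obtain c where c: "z = (\<Sum>i\<in>insert j A. c i *\<^sub>R a i)" "\<forall>i\<in>insert j A. 0 \<le> c i \<and> c i \<le> 1"
    by (auto simp: zonotope_def)
  then have "z = (\<Sum>i\<in>A. c i *\<^sub>R a i) + c j *\<^sub>R a j"
    using assms by simp
  moreover have "(\<Sum>i\<in>A. c i *\<^sub>R a i) \<in> zonotope A a"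
    using c(2) by (auto simp: zonotope_def)
  moreover have "c j *\<^sub>R a j \<in> (\<lambda>s. s *\<^sub>R a j) ` {0..1}"
    using c(2) by auto
  ultimately show "z \<in> {x + y | x y. x \<in> zonotope A a \<and> y \<in> (\<lambda>s. s *\<^sub>R a j) ` {0..1}}"
    by blast
next
  fix z assume "z \<in> {x + y | x y. x \<in> zonotope A a \<and> y \<in> (\<lambda>s. s *\<^sub>R a j) ` {0..1}}"
  then obtain c s where c: "\<forall>i\<in>A. 0 \<le> c i \<and> c i \<le> 1" "0 \<le> s" "s \<le> 1"
    and z: "z = (\<Sum>i\<in>A. c i *\<^sub>R a i) + s *\<^sub>R a j"
    by (auto simp: zonotope_def)
  have "(\<Sum>i\<in>A. (c(j := s)) i *\<^sub>R a i) = (\<Sum>i\<in>A. c i *\<^sub>R a i)"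
    using assms by (intro sum.cong) auto
  with z have "z = (\<Sum>i\<in>insert j A. (c(j := s)) i *\<^sub>R a i)"
    using assms by simp
  moreover have "\<forall>i\<in>insert j A. 0 \<le> (c(j := s)) i \<and> (c(j := s)) i \<le> 1"
    using c by auto
  ultimately show "z \<in> zonotope (insert j A) a"
    unfolding zonotope_def by blast
qed

lemma compact_zonotope:
  fixes a :: "'i \<Rightarrow> 'v::real_normed_vector"
  assumes "finite A"
  shows "compact (zonotope A a)"
  using assms
proof induction
  case (insert j A)
  have "compact ((\<lambda>s. s *\<^sub>R a j) ` {0..1})"
    by (intro compact_continuous_image continuous_intros compact_Icc)
  with insert show ?case
    by (simp add: zonotope_insert compact_sums)
qed simp

lemma convex_zonotope:
  assumes "finite A"
  shows "convex (zonotope A a)"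
  using assms
proof induction
  case (insert j A)
  have "linear (\<lambda>s. s *\<^sub>R a j)"
    by (simp add: linear_iff algebra_simps)
  then have "convex ((\<lambda>s. s *\<^sub>R a j) ` {0..1})"
    by (intro convex_linear_image) auto
  with insert.IH have "convex (\<Union>x\<in>zonotope A a. \<Union>y\<in>(\<lambda>s. s *\<^sub>R a j) ` {0..1}. {x + y})"
    by (rule convex_sums)
  also have "(\<Union>x\<in>zonotope A a. \<Union>y\<in>(\<lambda>s. s *\<^sub>R a j) ` {0..1}. {x + y}) = zonotope (insert j A) a"
    using insert.hyps by (auto simp: zonotope_insert)
  finally show ?case .
qed simp

lemma linear_image_zonotope:
  assumes "linear g"
  shows "g ` zonotope A a = zonotope A (\<lambda>i. g (a i))"
proof -
  have "g (\<Sum>i\<in>A. c i *\<^sub>R a i) = (\<Sum>i\<in>A. c i *\<^sub>R g (a i))" for c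
    by (simp add: linear_sum[OF assms] linear_scale[OF assms])
  then show ?thesis
    by (force simp: zonotope_def image_iff)
qed

subsection \<open>Half-open parallelepipeds and torsion\<close>

text \<open>Counting by fibres of equal size; it drives both deletion-contraction
  recursions.\<close>

lemma card_fibration:
  assumes "finite X" "finite Y" "q ` X \<subseteq> Y" "\<And>y. y \<in> Y \<Longrightarrow> card {x \<in> X. q x = y} = m"
  shows "card X = m * card Y"
  using sum.group[OF assms(1-3), of "\<lambda>_. 1::nat"] assms(4) by (simp add: mult.commute)

text \<open>Points of \<open>G\<close> in the half-open parallelepiped, recorded by coefficients.
  Extensional functions give one record per point when the family is independent.\<close>

definition box_coeffs :: "'v::real_vector set \<Rightarrow> 'i set \<Rightarrow> ('i \<Rightarrow> 'v) \<Rightarrow> ('i \<Rightarrow> real) set" where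
  "box_coeffs G B a = {c \<in> B \<rightarrow>\<^sub>E {0<..1}. (\<Sum>i\<in>B. c i *\<^sub>R a i) \<in> G}"

lemma independent_family_sum_eqD:
  assumes "independent_family a B" "finite B"
    "(\<Sum>i\<in>B. c i *\<^sub>R a i) = (\<Sum>i\<in>B. d i *\<^sub>R a i)" "i \<in> B"
  shows "c i = d i"
proof -
  have "(\<Sum>i\<in>B. (c i - d i) *\<^sub>R a i) = 0"
    using assms(3) by (simp add: algebra_simps sum_subtractf)
  then have "c i - d i = 0"
    using assms(1,4) independent_family_iff[OF assms(2), THEN iffD1, rule_format,
      of a "\<lambda>i. c i - d i"] by blast
  then show ?thesis by simp
qed

text \<open>Independence embeds the coefficients into the points of \<open>G\<close> in a compact
  zonotope.\<close>

lemma finite_box_coeffs: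
  fixes a :: "'i \<Rightarrow> 'v::euclidean_space"
  assumes G: "discrete_group G" and B: "finite B" "independent_family a B"
  shows "finite (box_coeffs G B a)"
proof (rule finite_imageD)
  have "(\<lambda>c. \<Sum>i\<in>B. c i *\<^sub>R a i) ` box_coeffs G B a \<subseteq> G \<inter> zonotope B a"
  proof (intro image_subsetI IntI)
    fix c assume c: "c \<in> box_coeffs G B a"
    then show "(\<Sum>i\<in>B. c i *\<^sub>R a i) \<in> G"
      by (simp add: box_coeffs_def)
    have "\<forall>i\<in>B. 0 \<le> c i \<and> c i \<le> 1"
      using c by (force simp: box_coeffs_def PiE_iff)
    then show "(\<Sum>i\<in>B. c i *\<^sub>R a i) \<in> zonotope B a"
      by (auto simp: zonotope_def)
  qed
  then show "finite ((\<lambda>c. \<Sum>i\<in>B. c i *\<^sub>R a i) ` box_coeffs G B a)"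
    using discrete_group_finite_Int[OF G compact_imp_bounded[OF compact_zonotope[OF B(1)]]]
    by (rule finite_subset)
  show "inj_on (\<lambda>c. \<Sum>i\<in>B. c i *\<^sub>R a i) (box_coeffs G B a)"
  proof (rule inj_onI, rule PiE_ext)
    fix c d i assume "(\<Sum>i\<in>B. c i *\<^sub>R a i) = (\<Sum>i\<in>B. d i *\<^sub>R a i)" "i \<in> B"
    then show "c i = d i"
      by (rule independent_family_sum_eqD[OF B(2,1)])
  qed (auto simp: box_coeffs_def)
qed

section \<open>Reduction of coefficients modulo 1\<close>

lemma sum_upper_frac:
  fixes a :: "'i \<Rightarrow> 'v::real_vector"
  shows "(\<Sum>i\<in>B. upper_frac (u i) *\<^sub>R a i) =
    (\<Sum>i\<in>B. u i *\<^sub>R a i) - (\<Sum>i\<in>B. of_int (\<lceil>u i\<rceil> - 1) *\<^sub>R a i)"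
  unfolding upper_frac_def scaleR_diff_left sum_subtractf ..

text \<open>Reducing the coefficients subtracts an integer combination of vectors of
  \<open>G\<close>, so the point stays in \<open>G\<close>.\<close>

lemma upper_frac_in_box_coeffs:
  assumes G: "discrete_group G" and "a ` B \<subseteq> G" "(\<Sum>i\<in>B. u i *\<^sub>R a i) \<in> G"
  shows "restrict (\<lambda>i. upper_frac (u i)) B \<in> box_coeffs G B a"
proof -
  have "(\<Sum>i\<in>B. of_int (\<lceil>u i\<rceil> - 1) *\<^sub>R a i) \<in> G"
    using assms by (intro discrete_group_sum[OF G] discrete_group_scaleR[OF G]) auto
  then have "(\<Sum>i\<in>B. upper_frac (u i) *\<^sub>R a i) \<in> G"
    unfolding sum_upper_frac using assms discrete_group_diff[OF G] by blast
  then show ?thesis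
    using upper_frac_bounds by (auto simp: box_coeffs_def)
qed

text \<open>Each torsion class has exactly one representative with coefficients in
  \<open>{0<..1}\<close>: torsion provides real coefficients, which can be reduced, and independence
  makes coefficients unique modulo 1. That every point of \<open>G\<close> in the box is torsion
  follows from the pigeonhole principle.\<close>

lemma card_quotient_torsion:
  fixes a :: "'i \<Rightarrow> 'v::euclidean_space"
  assumes G: "discrete_group G" and B: "finite B" "independent_family a B" "a ` B \<subseteq> G"
  shows "card (quotient_torsion G (group_closure (a ` B))) = card (box_coeffs G B a)"
proof -
  let ?H = "group_closure (a ` B)"
  let ?F = "\<lambda>c. (+) (\<Sum>i\<in>B. c i *\<^sub>R a i) ` ?H"
  have int_in: "(\<Sum>i\<in>B. of_int (n i) *\<^sub>R a i) \<in> ?H" for n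
    unfolding group_closure_image_eq[OF B(1)] by (rule rangeI)
  have "bij_betw ?F (box_coeffs G B a) (quotient_torsion G ?H)"
    unfolding bij_betw_def
  proof
    show "inj_on ?F (box_coeffs G B a)"
    proof (rule inj_onI)
      fix c d assume c: "c \<in> box_coeffs G B a" and d: "d \<in> box_coeffs G B a" and "?F c = ?F d"
      then have "(\<Sum>i\<in>B. c i *\<^sub>R a i) - (\<Sum>i\<in>B. d i *\<^sub>R a i) \<in> ?H"
        by (simp only: coset_group_closure_eq_iff)
      then obtain n where
        "(\<Sum>i\<in>B. c i *\<^sub>R a i) - (\<Sum>i\<in>B. d i *\<^sub>R a i) = (\<Sum>i\<in>B. of_int (n i) *\<^sub>R a i)"
        unfolding group_closure_image_eq[OF B(1)] by blast
      then have "(\<Sum>i\<in>B. c i *\<^sub>R a i) = (\<Sum>i\<in>B. (d i + of_int (n i)) *\<^sub>R a i)"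
        by (simp add: algebra_simps sum.distrib)
      \<comment> \<open>Independence turns congruence modulo \<open>?H\<close> into congruence of
        every coefficient modulo 1.\<close>
      then have eq: "c i = d i + of_int (n i)" if "i \<in> B" for i
        using independent_family_sum_eqD[OF B(2,1) _ that, of c "\<lambda>i. d i + of_int (n i)"] by blast
      show "c = d"
      proof (rule PiE_ext)
        fix i assume i: "i \<in> B"
        have "upper_frac (c i) = upper_frac (d i)"
          unfolding eq[OF i] by simp
        then show "c i = d i"
          using c d i by (auto simp: box_coeffs_def PiE_iff upper_frac_eq_self)
      qed (use c d in \<open>auto simp: box_coeffs_def\<close>)
    qed
    show "?F ` box_coeffs G B a = quotient_torsion G ?H"
    proof (intro equalityI subsetI)
      fix T assume "T \<in> ?F ` box_coeffs G B a"
      then obtain c where c: "c \<in> box_coeffs G B a" and T: "T = ?F c" by blast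
      define x where "x = (\<Sum>i\<in>B. c i *\<^sub>R a i)"
      have x: "x \<in> G"
        using c by (simp add: x_def box_coeffs_def)
      have mult: "real k *\<^sub>R x = (\<Sum>i\<in>B. (real k * c i) *\<^sub>R a i)" for k
        by (simp add: x_def scaleR_right.sum)
      \<comment> \<open>Two multiples of \<open>x\<close> agree modulo \<open>H\<close>, as their reductions lie in a finite set.\<close>
      define r where "r k = restrict (\<lambda>i. upper_frac (real k * c i)) B" for k :: nat
      have "range r \<subseteq> box_coeffs G B a"
      proof clarify
        fix k
        have "real k *\<^sub>R x \<in> G"
          using discrete_group_scaleR[OF G x, of "int k"] by simp
        then show "r k \<in> box_coeffs G B a"
          unfolding r_def mult by (rule upper_frac_in_box_coeffs[OF G B(3)])
      qed
      then have "finite (range r)"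
        using finite_box_coeffs[OF G B(1,2)] by (rule finite_subset)
      then have "\<not> inj r"
        using finite_imageD by blast
      then obtain k l where kl: "r k = r l" "k < l"
        by (metis injI linorder_neq_iff)
      have "(\<Sum>i\<in>B. upper_frac (real k * c i) *\<^sub>R a i) = (\<Sum>i\<in>B. upper_frac (real l * c i) *\<^sub>R a i)"
        using fun_cong[OF kl(1)] by (intro sum.cong refl) (metis r_def restrict_apply')
      then have "real l *\<^sub>R x - real k *\<^sub>R x =
          (\<Sum>i\<in>B. of_int (\<lceil>real l * c i\<rceil> - 1) *\<^sub>R a i) - (\<Sum>i\<in>B. of_int (\<lceil>real k * c i\<rceil> - 1) *\<^sub>R a i)"
        unfolding sum_upper_frac mult by (simp add: algebra_simps)
      also have "\<dots> \<in> ?H"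
        by (intro group_closure.diff int_in)
      finally have "real (l - k) *\<^sub>R x \<in> ?H"
        using kl(2) by (simp add: of_nat_diff algebra_simps)
      then show "T \<in> quotient_torsion G ?H"
        using T x kl(2) unfolding quotient_torsion_def x_def[symmetric]
        by (intro CollectI exI[of _ x]) (auto intro!: exI[of _ "l - k"])
    next
      fix T assume "T \<in> quotient_torsion G ?H"
      then obtain x and m :: nat where T: "T = (+) x ` ?H" and x: "x \<in> G" and
        m: "m > 0" "real m *\<^sub>R x \<in> ?H"
        by (auto simp: quotient_torsion_def)
      obtain n where n: "real m *\<^sub>R x = (\<Sum>i\<in>B. of_int (n i) *\<^sub>R a i)"
        using m(2) unfolding group_closure_image_eq[OF B(1)] by blast
      \<comment> \<open>Dividing the torsion relation by \<open>m\<close> expresses \<open>x\<close>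
        with rational coefficients, whose reductions give the representative.\<close>
      have "x = (1 / real m) *\<^sub>R (real m *\<^sub>R x)"
        using m(1) by simp
      also have "\<dots> = (\<Sum>i\<in>B. (of_int (n i) / real m) *\<^sub>R a i)"
        unfolding n by (simp add: scaleR_right.sum)
      finally have x_eq: "x = (\<Sum>i\<in>B. (of_int (n i) / real m) *\<^sub>R a i)" .
      define c where "c = restrict (\<lambda>i. upper_frac (of_int (n i) / real m)) B"
      have "c \<in> box_coeffs G B a"
        unfolding c_def using x[unfolded x_eq] by (rule upper_frac_in_box_coeffs[OF G B(3)])
      moreover have "(\<Sum>i\<in>B. c i *\<^sub>R a i) = (\<Sum>i\<in>B. upper_frac (of_int (n i) / real m) *\<^sub>R a i)"
        by (intro sum.cong) (auto simp: c_def)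
      then have "x - (\<Sum>i\<in>B. c i *\<^sub>R a i) = (\<Sum>i\<in>B. of_int (\<lceil>of_int (n i) / real m\<rceil> - 1) *\<^sub>R a i)"
        unfolding sum_upper_frac x_eq[symmetric] by simp
      then have "x - (\<Sum>i\<in>B. c i *\<^sub>R a i) \<in> ?H"
        by (simp only: int_in)
      then have "T = ?F c"
        unfolding T by (simp only: coset_group_closure_eq_iff)
      ultimately show "T \<in> ?F ` box_coeffs G B a" by blast
    qed
  qed
  then show ?thesis
    by (simp add: bij_betw_same_card)
qed

text \<open>For \<open>c \<in> {0<..1}\<close>, the number \<open>k * c\<close> splits uniquely as
  \<open>n + d\<close> with \<open>n \<in> {..<k}\<close> and \<open>d \<in> {0<..1}\<close>. Here
  \<open>n\<close> selects a translate of the original box and \<open>d\<close> a point in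
  it.\<close>

lemma card_box_coeffs_scaleR:
  assumes G: "discrete_group G" and B: "finite B" "a ` B \<subseteq> G" and k: "k > 0"
  shows "card (box_coeffs G B (\<lambda>i. real k *\<^sub>R a i)) = k ^ card B * card (box_coeffs G B a)"
proof -
  let ?f = "\<lambda>c. (\<lambda>i\<in>B. nat (\<lceil>real k * c i\<rceil> - 1), \<lambda>i\<in>B. upper_frac (real k * c i))"
  let ?g = "\<lambda>(n, d). \<lambda>i\<in>B. (real (n i) + d i) / real k"
  \<comment> \<open>As \<open>d\<close> may equal 1 but not 0, the integer part is the ceiling minus
    1 and not the floor.\<close>
  have ceil: "\<lceil>real n + d\<rceil> = int n + 1" if "d \<in> {0<..1}" for n d
    using that by (intro ceiling_unique) auto
  have "bij_betw ?f (box_coeffs G B (\<lambda>i. real k *\<^sub>R a i)) ((B \<rightarrow>\<^sub>E {..<k}) \<times> box_coeffs G B a)"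
  proof (rule bij_betw_byWitness[where f' = ?g])
    show "\<forall>c\<in>box_coeffs G B (\<lambda>i. real k *\<^sub>R a i). ?g (?f c) = c"
    proof
      fix c assume c: "c \<in> box_coeffs G B (\<lambda>i. real k *\<^sub>R a i)"
      have "?g (?f c) i = c i" if "i \<in> B" for i
      proof -
        have "real k * c i > 0"
          using c k that by (auto simp: box_coeffs_def PiE_iff)
        then have "real (nat (\<lceil>real k * c i\<rceil> - 1)) + upper_frac (real k * c i) = real k * c i"
          by (simp add: upper_frac_def)
        then show ?thesis
          using k that by simp
      qed
      then show "?g (?f c) = c"
        using c by (intro ext) (auto simp: box_coeffs_def PiE_iff extensional_def)
    qed
    show "\<forall>x\<in>(B \<rightarrow>\<^sub>E {..<k}) \<times> box_coeffs G B a. ?f (?g x) = x"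
    proof
      fix x assume "x \<in> (B \<rightarrow>\<^sub>E {..<k}) \<times> box_coeffs G B a"
      then obtain n d where x: "x = (n, d)"
        and n: "n \<in> B \<rightarrow>\<^sub>E {..<k}" and d: "d \<in> box_coeffs G B a" by blast
      have di: "d i \<in> {0<..1}" if "i \<in> B" for i
        using d that by (auto simp: box_coeffs_def PiE_iff)
      have "(\<lambda>i\<in>B. nat (\<lceil>real k * ?g (n, d) i\<rceil> - 1)) = n"
        using n k ceil[OF di] by (auto simp: fun_eq_iff PiE_iff extensional_def)
      moreover have "(\<lambda>i\<in>B. upper_frac (real k * ?g (n, d) i)) = d"
        using d k ceil[OF di]
        by (auto simp: fun_eq_iff box_coeffs_def PiE_iff extensional_def upper_frac_def)
      ultimately show "?f (?g x) = x"
        unfolding x by (simp only:)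
    qed
    show "?f ` box_coeffs G B (\<lambda>i. real k *\<^sub>R a i) \<subseteq> (B \<rightarrow>\<^sub>E {..<k}) \<times> box_coeffs G B a"
    proof (intro image_subsetI SigmaI)
      fix c assume c: "c \<in> box_coeffs G B (\<lambda>i. real k *\<^sub>R a i)"
      have "nat (\<lceil>real k * c i\<rceil> - 1) < k" if "i \<in> B" for i
      proof -
        have "real k * c i \<le> real k"
          using c k that by (auto simp: box_coeffs_def PiE_iff mult_left_le)
        then have "\<lceil>real k * c i\<rceil> \<le> int k"
          by (simp add: ceiling_le_iff)
        then show ?thesis
          using k by linarith
      qed
      then show "(\<lambda>i\<in>B. nat (\<lceil>real k * c i\<rceil> - 1)) \<in> B \<rightarrow>\<^sub>E {..<k}"
        by auto
      have "(\<Sum>i\<in>B. (real k * c i) *\<^sub>R a i) \<in> G"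
        using c by (simp add: box_coeffs_def mult.commute)
      then show "(\<lambda>i\<in>B. upper_frac (real k * c i)) \<in> box_coeffs G B a"
        by (rule upper_frac_in_box_coeffs[OF G B(2)])
    qed
    show "?g ` ((B \<rightarrow>\<^sub>E {..<k}) \<times> box_coeffs G B a) \<subseteq> box_coeffs G B (\<lambda>i. real k *\<^sub>R a i)"
    proof (rule image_subsetI)
      fix x assume "x \<in> (B \<rightarrow>\<^sub>E {..<k}) \<times> box_coeffs G B a"
      then obtain n d where x: "x = (n, d)"
        and n: "n \<in> B \<rightarrow>\<^sub>E {..<k}" and d: "d \<in> box_coeffs G B a" by blast
      have "(real (n i) + d i) / real k \<in> {0<..1}" if "i \<in> B" for i
      proof -
        have "real (n i) + 1 \<le> real k"
          using n that by (force simp: PiE_iff)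
        then show ?thesis
          using d that k by (auto simp: box_coeffs_def PiE_iff field_simps)
      qed
      moreover have "(\<Sum>i\<in>B. ?g (n, d) i *\<^sub>R (real k *\<^sub>R a i)) =
          (\<Sum>i\<in>B. of_int (int (n i)) *\<^sub>R a i) + (\<Sum>i\<in>B. d i *\<^sub>R a i)"
        unfolding sum.distrib[symmetric] using k by (intro sum.cong) (auto simp flip: scaleR_add_left)
      moreover have "\<dots> \<in> G"
      proof (rule discrete_group_add[OF G])
        show "(\<Sum>i\<in>B. of_int (int (n i)) *\<^sub>R a i) \<in> G"
          using B(2) by (intro discrete_group_sum[OF G] discrete_group_scaleR[OF G]) auto
        show "(\<Sum>i\<in>B. d i *\<^sub>R a i) \<in> G"
          using d by (simp add: box_coeffs_def)
      qed
      ultimately show "?g x \<in> box_coeffs G B (\<lambda>i. real k *\<^sub>R a i)"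
        unfolding x by (simp add: box_coeffs_def)
    qed
  qed
  then have "card (box_coeffs G B (\<lambda>i. real k *\<^sub>R a i)) = card ((B \<rightarrow>\<^sub>E {..<k}) \<times> box_coeffs G B a)"
    by (rule bij_betw_same_card)
  then show ?thesis
    using B(1) by (simp add: card_cartesian_product card_PiE)
qed

subsection \<open>Deletion and contraction\<close>

text \<open>With \<open>f\<close> linear and \<open>f e = 1\<close>, this is a model of the quotient by \<open>\<real>e\<close> inside the same type.\<close>

definition contract :: "('v::real_vector \<Rightarrow> real) \<Rightarrow> 'v \<Rightarrow> 'v \<Rightarrow> 'v" where
  "contract f e x = x - f x *\<^sub>R e"

context
  fixes f :: "'v::euclidean_space \<Rightarrow> real" and e :: 'v
  assumes f: "linear f" "f e = 1"
begin

lemma linear_contract: "linear (contract f e)"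
  by (rule linearI)
    (simp_all add: contract_def linear_add[OF f(1)] linear_scale[OF f(1)] algebra_simps)

lemma contract_self [simp]: "contract f e e = 0"
  by (simp add: contract_def f)

lemma contract_add_scaleR [simp]: "contract f e (x + s *\<^sub>R e) = contract f e x"
  by (simp add: linear_add[OF linear_contract] linear_scale[OF linear_contract])

lemma contract_decomp: "x = contract f e x + f x *\<^sub>R e"
  by (simp add: contract_def)

lemma contract_eqD: "contract f e x = contract f e y \<Longrightarrow> y = x + (f y - f x) *\<^sub>R e"
  by (simp add: contract_def algebra_simps)

lemma contract_sum: "contract f e (\<Sum>i\<in>B. u i *\<^sub>R a i) = (\<Sum>i\<in>B. u i *\<^sub>R contract f e (a i))"
  by (simp add: linear_sum[OF linear_contract] linear_scale[OF linear_contract])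

text \<open>Adding an integer multiple of \<open>e\<close> moves a preimage of a point
  \<open>y\<close> of \<open>S\<close> to within a segment of \<open>y\<close>. So the image in
  \<open>S\<close> comes from a bounded, hence finite, part of \<open>G\<close>.\<close>

lemma discrete_group_contract:
  assumes G: "discrete_group G" and e: "e \<in> G"
  shows "discrete_group (contract f e ` G)"
  unfolding discrete_group_def
proof (intro conjI ballI allI impI)
  show "0 \<in> contract f e ` G"
    using e by (intro image_eqI[of _ _ e]) auto
  fix x y assume "x \<in> contract f e ` G" "y \<in> contract f e ` G"
  then obtain x' y' where "x = contract f e x'" "y = contract f e y'" "x' \<in> G" "y' \<in> G" by blast
  then show "x - y \<in> contract f e ` G"
    using discrete_group_diff[OF G]
    by (intro image_eqI[of _ _ "x' - y'"]) (auto simp: linear_diff[OF linear_contract])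
next
  fix S :: "'v set" assume "bounded S"
  moreover have "bounded ((\<lambda>s. s *\<^sub>R e) ` {0..1})"
    by (intro compact_imp_bounded compact_continuous_image continuous_intros compact_Icc)
  ultimately have "bounded (\<Union>x\<in>S. \<Union>y\<in>(\<lambda>s. s *\<^sub>R e) ` {0..1}. {x + y})" (is "bounded ?T")
    by (rule bounded_sums)
  then have "finite (G \<inter> ?T)"
    by (rule discrete_group_finite_Int[OF G])
  moreover have "contract f e ` G \<inter> S \<subseteq> contract f e ` (G \<inter> ?T)"
  proof
    fix y assume y: "y \<in> contract f e ` G \<inter> S"
    then obtain x where x: "x \<in> G" "y = contract f e x" by blast
    let ?z = "x + of_int (- \<lfloor>f x\<rfloor>) *\<^sub>R e"
    have "?z = y + frac (f x) *\<^sub>R e"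
      by (simp add: x(2) contract_def frac_def algebra_simps)
    moreover have "frac (f x) *\<^sub>R e \<in> (\<lambda>s. s *\<^sub>R e) ` {0..1}"
      using frac_lt_1[of "f x"] by (intro imageI) auto
    ultimately have "?z \<in> ?T"
      using y by blast
    moreover have "?z \<in> G"
      by (intro discrete_group_add[OF G] discrete_group_scaleR[OF G] x e)
    moreover have "y = contract f e ?z"
      by (simp only: contract_add_scaleR x(2))
    ultimately show "y \<in> contract f e ` (G \<inter> ?T)" by blast
  qed
  ultimately show "finite (contract f e ` G \<inter> S)"
    using finite_subset by blast
qed

text \<open>Contraction kills the \<open>e\<close>-term of a relation; conversely, a relation modulo
  \<open>e\<close> becomes a genuine one after adding a multiple of \<open>e\<close>.\<close>

lemma independent_family_insert_iff:
  assumes "finite B" "j \<notin> B" "a j = e"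
  shows "independent_family a (insert j B) \<longleftrightarrow> independent_family (\<lambda>i. contract f e (a i)) B"
proof -
  have e0: "e \<noteq> 0"
    using f linear_0 by fastforce
  have fin: "finite (insert j B)"
    using assms by simp
  show ?thesis
    unfolding independent_family_iff[OF assms(1)] independent_family_iff[OF fin]
  proof (intro iffI allI impI ballI)
    fix u i assume *: "\<forall>u. (\<Sum>i\<in>insert j B. u i *\<^sub>R a i) = 0 \<longrightarrow> (\<forall>i\<in>insert j B. u i = 0)"
      and u: "(\<Sum>i\<in>B. u i *\<^sub>R contract f e (a i)) = 0" and i: "i \<in> B"
    let ?x = "\<Sum>i\<in>B. u i *\<^sub>R a i"
    \<comment> \<open>As \<open>?x\<close> contracts to 0, it equals
      \<open>f ?x *\<^sub>R e\<close>; this coefficient at \<open>j\<close> cancels it.\<close>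
    let ?u = "u(j := - f ?x)"
    have "contract f e ?x = 0"
      using u by (simp only: contract_sum)
    then have "?x = f ?x *\<^sub>R e"
      using contract_decomp[of ?x] by simp
    moreover have "(\<Sum>i\<in>B. ?u i *\<^sub>R a i) = ?x"
      using assms(2) by (intro sum.cong) auto
    ultimately have "(\<Sum>i\<in>insert j B. ?u i *\<^sub>R a i) = 0"
      using assms by (simp del: fun_upd_apply) simp
    then have "?u i = 0"
      using * i by blast
    then show "u i = 0"
      using assms(2) i by (auto split: if_splits)
  next
    fix u i assume *: "\<forall>u. (\<Sum>i\<in>B. u i *\<^sub>R contract f e (a i)) = 0 \<longrightarrow> (\<forall>i\<in>B. u i = 0)"
      and u: "(\<Sum>i\<in>insert j B. u i *\<^sub>R a i) = 0" and i: "i \<in> insert j B"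
    have "(\<Sum>i\<in>insert j B. u i *\<^sub>R contract f e (a i)) = 0"
      using u contract_sum[of u a "insert j B"] linear_0[OF linear_contract] by simp
    then have "\<forall>i\<in>B. u i = 0"
      using assms * by simp
    with u e0 i assms show "u i = 0"
      by auto
  qed
qed

text \<open>Forgetting the coefficient of \<open>e\<close> maps the box to the box of the
  contraction. Each fibre consists of the points of \<open>G\<close> on a half-open unit segment
  parallel to \<open>e\<close>, and all such segments give the same count.\<close>

lemma card_box_coeffs_insert:
  assumes G: "discrete_group G" and e: "e \<in> G" and B: "finite B" "j \<notin> B" "a j = e"
    and ind: "independent_family a (insert j B)"
  shows "card (box_coeffs G (insert j B) a) =
    card {s \<in> {0<..1}. s *\<^sub>R e \<in> G} * card (box_coeffs (contract f e ` G) B (\<lambda>i. contract f e (a i)))"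
proof (rule card_fibration[where q = "\<lambda>c. restrict c B"])
  show "finite (box_coeffs G (insert j B) a)"
    using finite_box_coeffs[OF G _ ind] B by simp
  show "finite (box_coeffs (contract f e ` G) B (\<lambda>i. contract f e (a i)))"
    using finite_box_coeffs[OF discrete_group_contract[OF G e] B(1)] ind
    by (simp add: independent_family_insert_iff[of B j a, OF B])
  show "(\<lambda>c. restrict c B) ` box_coeffs G (insert j B) a \<subseteq>
      box_coeffs (contract f e ` G) B (\<lambda>i. contract f e (a i))"
  proof clarify
    fix c assume c: "c \<in> box_coeffs G (insert j B) a"
    have "(\<Sum>i\<in>insert j B. c i *\<^sub>R a i) = (\<Sum>i\<in>B. c i *\<^sub>R a i) + c j *\<^sub>R e"
      using B by simp
    then have "contract f e (\<Sum>i\<in>insert j B. c i *\<^sub>R a i) = (\<Sum>i\<in>B. c i *\<^sub>R contract f e (a i))"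
      by (simp only: contract_add_scaleR contract_sum)
    then have "(\<Sum>i\<in>B. c i *\<^sub>R contract f e (a i)) \<in> contract f e ` G"
      using c by (auto simp: box_coeffs_def intro: image_eqI[OF sym])
    then show "restrict c B \<in> box_coeffs (contract f e ` G) B (\<lambda>i. contract f e (a i))"
      using c by (auto simp: box_coeffs_def)
  qed
next
  fix y assume y: "y \<in> box_coeffs (contract f e ` G) B (\<lambda>i. contract f e (a i))"
  let ?x = "\<Sum>i\<in>B. y i *\<^sub>R a i"
  have "contract f e ?x \<in> contract f e ` G"
    using y by (simp add: contract_sum box_coeffs_def)
  then obtain g where "g \<in> G" "contract f e ?x = contract f e g" by blast
  \<comment> \<open>A lift \<open>g\<close> of the contracted point puts an element of
    \<open>G\<close> on the line through \<open>?x\<close>, as the line count requires.\<close>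
  then have t: "?x + (f g - f ?x) *\<^sub>R e \<in> G"
    using contract_eqD[of ?x g] by simp
  have upd: "(\<Sum>i\<in>insert j B. (y(j := s)) i *\<^sub>R a i) = ?x + s *\<^sub>R e" for s
  proof -
    have "(\<Sum>i\<in>B. (y(j := s)) i *\<^sub>R a i) = ?x"
      using B by (intro sum.cong) auto
    then show ?thesis
      using B by simp
  qed
  \<comment> \<open>The interval \<open>{0<..0+1}\<close> is the case \<open>h = 0\<close> of
    \<open>card_unit_interval_line\<close>.\<close>
  have "bij_betw (\<lambda>c. c j) {c \<in> box_coeffs G (insert j B) a. restrict c B = y}
      {s \<in> {0<..0+1}. ?x + s *\<^sub>R e \<in> G}"
  proof (rule bij_betw_byWitness[where f' = "\<lambda>s. y(j := s)"])
    have ext: "c = y(j := c j)" if "c \<in> insert j B \<rightarrow>\<^sub>E {0<..1}" "restrict c B = y" for c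
      using that(1) by (auto simp: that(2)[symmetric] fun_eq_iff PiE_iff extensional_def)
    show "\<forall>c\<in>{c \<in> box_coeffs G (insert j B) a. restrict c B = y}. y(j := c j) = c"
      using ext[symmetric] by (simp add: box_coeffs_def)
    show "(\<lambda>c. c j) ` {c \<in> box_coeffs G (insert j B) a. restrict c B = y} \<subseteq>
        {s \<in> {0<..0+1}. ?x + s *\<^sub>R e \<in> G}"
    proof clarify
      fix c assume c: "c \<in> box_coeffs G (insert j B) a" "y = restrict c B"
      then have "c = y(j := c j)"
        using ext by (simp add: box_coeffs_def)
      with c(1) upd[of "c j"] have "?x + c j *\<^sub>R e \<in> G"
        by (simp add: box_coeffs_def)
      with c show "c j \<in> {0<..0 + 1} \<and> (\<Sum>i\<in>B. restrict c B i *\<^sub>R a i) + c j *\<^sub>R e \<in> G"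
        by (auto simp: box_coeffs_def PiE_iff)
    qed
    show "(\<lambda>s. y(j := s)) ` {s \<in> {0<..0+1}. ?x + s *\<^sub>R e \<in> G} \<subseteq>
        {c \<in> box_coeffs G (insert j B) a. restrict c B = y}"
    proof clarify
      fix s :: real assume s: "s \<in> {0<..0+1}" "?x + s *\<^sub>R e \<in> G"
      have "y(j := s) \<in> insert j B \<rightarrow>\<^sub>E {0<..1}"
        using y s by (auto simp: box_coeffs_def PiE_iff extensional_def)
      moreover have "restrict (y(j := s)) B = y"
        using y B(2) by (auto simp: box_coeffs_def PiE_iff extensional_def fun_eq_iff)
      ultimately show "y(j := s) \<in> box_coeffs G (insert j B) a \<and> restrict (y(j := s)) B = y"
        using s(2) unfolding box_coeffs_def upd[symmetric] by blast
    qed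
  qed simp
  then show "card {c \<in> box_coeffs G (insert j B) a. restrict c B = y} = card {s \<in> {0<..1}. s *\<^sub>R e \<in> G}"
    using card_unit_interval_line[OF G e t, of 0] by (simp add: bij_betw_same_card)
qed

text \<open>Both zonotopes have the same projection along \<open>e\<close>. Over each projected
  point of \<open>G\<close>, the new points fill a half-open segment of length \<open>e\<close> that
  lies on a line meeting \<open>G\<close>, so the fibre count is constant.\<close>

lemma card_zonotope_insert:
  assumes G: "discrete_group G" and e: "e \<in> G" and A: "finite A" "j \<notin> A" "a j = e"
  shows "card (zonotope (insert j A) a \<inter> G) = card (zonotope A a \<inter> G) +
    card {s \<in> {0<..1}. s *\<^sub>R e \<in> G} *
    card (zonotope A (\<lambda>i. contract f e (a i)) \<inter> contract f e ` G)"
proof -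
  let ?Z = "zonotope A a" and ?Z' = "zonotope (insert j A) a"
  let ?X = "(?Z' - ?Z) \<inter> G"
  let ?Y = "zonotope A (\<lambda>i. contract f e (a i)) \<inter> contract f e ` G"
  have Z': "z \<in> ?Z' \<longleftrightarrow> (\<exists>x s. z = x + s *\<^sub>R e \<and> x \<in> ?Z \<and> 0 \<le> s \<and> s \<le> 1)" for z
    unfolding zonotope_insert[OF A(1,2)] A(3) by force
  have sub: "?Z \<subseteq> ?Z'"
    by (force simp: Z')
  have fin: "finite (zonotope C b \<inter> L)" if "finite C" "discrete_group L"
    for C :: "'i set" and b :: "'i \<Rightarrow> 'v" and L
    using discrete_group_finite_Int[OF that(2) compact_imp_bounded[OF compact_zonotope[OF that(1)]]]
    by (simp add: Int_commute)
  have finX: "finite ?X"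
    by (rule finite_subset[OF _ fin[of "insert j A" G a]]) (use A(1) G in auto)
  have "?Z' \<inter> G = (?Z \<inter> G) \<union> ?X"
    using sub by auto
  then have "card (?Z' \<inter> G) = card (?Z \<inter> G) + card ?X"
    using fin[OF A(1) G] finX by (subst card_Un_disjoint[symmetric]) auto
  also have "card ?X = card {s \<in> {0<..1}. s *\<^sub>R e \<in> G} * card ?Y"
  proof (rule card_fibration[where q = "contract f e"])
    show "finite ?Y"
      by (rule fin[OF A(1) discrete_group_contract[OF G e]])
    show "contract f e ` ?X \<subseteq> ?Y"
      unfolding linear_image_zonotope[OF linear_contract, symmetric] by (auto simp: Z')
  next
    fix y assume y: "y \<in> ?Y"
    then obtain g where g: "g \<in> G" "y = contract f e g" by blast
    obtain z0 where z0: "z0 \<in> ?Z" "y = contract f e z0"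
      using y unfolding linear_image_zonotope[OF linear_contract, symmetric] by blast
    have fy: "f y = 0"
      by (simp add: z0 contract_def linear_diff[OF f(1)] linear_scale[OF f(1)] f(2))
    have line: "y + f x *\<^sub>R e = x" if "contract f e x = y" for x
      using contract_decomp[of x] that by simp
    have f_line: "f (y + s *\<^sub>R e) = s" for s
      by (simp add: linear_add[OF f(1)] linear_scale[OF f(1)] f(2) fy)
    have yy: "contract f e y = y"
      by (simp add: contract_def fy)
    \<comment> \<open>The fibre of \<open>?Z\<close> over \<open>y\<close> is compact, so
      \<open>f\<close> attains a maximum on it.\<close>
    have "closed {x. contract f e x = y}"
      using linear_continuous_on[of "contract f e" UNIV] linear_contract
      by (intro closed_Collect_eq) (auto simp: linear_conv_bounded_linear)
    then have "compact (?Z \<inter> {x. contract f e x = y})"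
      by (rule compact_Int_closed[OF compact_zonotope[OF A(1)]])
    then have "compact (f ` (?Z \<inter> {x. contract f e x = y}))"
      using f(1)
      by (intro compact_continuous_image linear_continuous_on) (simp add: linear_conv_bounded_linear)
    moreover have "f ` (?Z \<inter> {x. contract f e x = y}) \<noteq> {}"
      using z0 by auto
    ultimately obtain z1 where z1: "z1 \<in> ?Z" "contract f e z1 = y"
      and max: "\<And>z. z \<in> ?Z \<Longrightarrow> contract f e z = y \<Longrightarrow> f z \<le> f z1"
      by (auto dest!: compact_attains_sup)
    define h where "h = f z1"
    have z1_eq: "z1 = y + h *\<^sub>R e"
      using line[OF z1(2)] by (simp add: h_def)
    \<comment> \<open>Over \<open>y\<close>, the zonotope grows by a half-open segment starting at the topmost point \<open>z1\<close>.\<close>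
    have iff: "y + s *\<^sub>R e \<in> ?Z' - ?Z \<longleftrightarrow> s \<in> {h<..h+1}" for s
    proof
      assume "y + s *\<^sub>R e \<in> ?Z' - ?Z"
      then obtain x u where xu: "y + s *\<^sub>R e = x + u *\<^sub>R e" "x \<in> ?Z" "0 \<le> u" "u \<le> 1"
        and notin: "y + s *\<^sub>R e \<notin> ?Z"
        by (auto simp: Z')
      have cx: "contract f e x = y"
        using arg_cong[OF xu(1), of "contract f e"] by (simp add: yy)
      have fx: "f x = s - u"
        using arg_cong[OF xu(1), of f] f_line[of s]
        by (simp add: linear_add[OF f(1)] linear_scale[OF f(1)] f(2))
      have "s \<le> h + 1"
        using max[OF xu(2) cx] fx xu by (simp add: h_def)
      moreover have "h < s"
      proof (rule ccontr)
        assume "\<not> h < s"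
        \<comment> \<open>If \<open>s \<le> h\<close>, the point would lie between \<open>x\<close>
          and \<open>z1\<close> on the line, hence in \<open>?Z\<close> by convexity.\<close>
        then have s: "s \<in> closed_segment (f x) (f z1)"
          using fx xu by (simp add: closed_segment_eq_real_ivl h_def)
        have conv: "convex {s. y + s *\<^sub>R e \<in> ?Z}"
        proof -
          have "{s. y + s *\<^sub>R e \<in> ?Z} = (\<lambda>s. s *\<^sub>R e) -` ((+) (- y) ` ?Z)"
            by (force simp: image_iff)
          moreover have "linear (\<lambda>s. s *\<^sub>R e)"
            by (simp add: linear_iff algebra_simps)
          ultimately show ?thesis
            using convex_linear_vimage convex_translation[OF convex_zonotope[OF A(1)]] by metis
        qed
        have "f x \<in> {s. y + s *\<^sub>R e \<in> ?Z}" "f z1 \<in> {s. y + s *\<^sub>R e \<in> ?Z}"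
          using xu(2) z1(1) by (simp_all add: line[OF cx] line[OF z1(2)])
        from subsetD[OF closed_segment_subset[OF this conv] s] notin show False by simp
      qed
      ultimately show "s \<in> {h<..h+1}" by simp
    next
      assume s: "s \<in> {h<..h+1}"
      have "y + s *\<^sub>R e = z1 + (s - h) *\<^sub>R e"
        by (subst z1_eq) (simp add: algebra_simps)
      then have "y + s *\<^sub>R e \<in> ?Z'"
        unfolding Z' using s z1(1) by (intro exI[of _ z1] exI[of _ "s - h"]) auto
      moreover have "y + s *\<^sub>R e \<notin> ?Z"
        using max[of "y + s *\<^sub>R e"] s by (auto simp: f_line yy h_def)
      ultimately show "y + s *\<^sub>R e \<in> ?Z' - ?Z" by blast
    qed
    have "bij_betw f {x \<in> ?X. contract f e x = y} {s \<in> {h<..h+1}. y + s *\<^sub>R e \<in> G}"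
    proof (rule bij_betw_byWitness[where f' = "\<lambda>s. y + s *\<^sub>R e"])
      show "\<forall>x\<in>{x \<in> ?X. contract f e x = y}. y + f x *\<^sub>R e = x"
        using line by auto
      show "f ` {x \<in> ?X. contract f e x = y} \<subseteq> {s \<in> {h<..h+1}. y + s *\<^sub>R e \<in> G}"
        unfolding iff[symmetric] by (auto simp flip: contract_decomp)
      show "(\<lambda>s. y + s *\<^sub>R e) ` {s \<in> {h<..h+1}. y + s *\<^sub>R e \<in> G} \<subseteq> {x \<in> ?X. contract f e x = y}"
        unfolding iff[symmetric] by (auto simp: yy)
    qed (simp add: f_line)
    moreover have "y + f g *\<^sub>R e \<in> G"
      using g(1) by (simp add: line[OF g(2)[symmetric]])
    ultimately show "card {x \<in> ?X. contract f e x = y} = card {s \<in> {0<..1}. s *\<^sub>R e \<in> G}"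
      using card_unit_interval_line[OF G e, of y "f g" h] by (simp add: bij_betw_same_card)
  qed (rule finX)
  finally show ?thesis .
qed

end

text \<open>Stanley's formula by induction on \<open>A\<close>. Both \<open>G\<close> and
  \<open>a\<close> are generalised because the contraction branch applies the hypothesis to the
  projected group and vectors; contraction inside the same type makes this possible.\<close>

theorem card_zonotope_Int:
  fixes a :: "'i \<Rightarrow> 'v::euclidean_space"
  assumes "finite A" "discrete_group G" "a ` A \<subseteq> G"
  shows "card (zonotope A a \<inter> G) =
    (\<Sum>B | B \<subseteq> A \<and> independent_family a B. card (box_coeffs G B a))"
  using assms
proof (induction A arbitrary: G a rule: finite_induct)
  case empty
  have "{B. B \<subseteq> {} \<and> independent_family a B} = {{}}"
    by (auto simp: independent_family_def independent_empty)
  \<comment> \<open>The empty box counts once: its sole extensional function has empty sum 0, which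
    matches the single point of the empty zonotope.\<close>
  moreover have "box_coeffs G {} a = {\<lambda>_. undefined}"
    using discrete_group_zero[OF empty.prems(1)] by (auto simp: box_coeffs_def)
  ultimately show ?case
    using discrete_group_zero[OF empty.prems(1)] by simp
next
  case (insert j A)
  note G = \<open>discrete_group G\<close>
  let ?S = "\<lambda>A. {B. B \<subseteq> A \<and> independent_family a B}"
  have IH: "card (zonotope A a \<inter> G) = (\<Sum>B\<in>?S A. card (box_coeffs G B a))"
    using insert.IH[OF G] insert.prems by auto
  show ?case
  proof (cases "a j = 0")
    case True
    \<comment> \<open>A zero vector neither enlarges the zonotope nor belongs to an independent
      subfamily.\<close>
    have "zonotope (insert j A) a = zonotope A a"
      unfolding zonotope_insert[OF insert.hyps] True by force
    moreover have "j \<notin> B" if "independent_family a B" for B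
      using that True dependent_zero[of "a ` B"] by (auto simp: independent_family_def image_iff)
    then have "?S (insert j A) = ?S A" by blast
    ultimately show ?thesis
      using IH by simp
  next
    case False
    define e where "e = a j"
    have eG: "e \<in> G"
      using insert.prems by (simp add: e_def)
    have "independent {e}"
      using False by (simp add: e_def)
    then obtain f :: "'v \<Rightarrow> real" where f: "linear f" "f e = 1"
      using linear_independent_extend[of "{e}" "\<lambda>_. 1"] by auto
    let ?a = "\<lambda>i. contract f e (a i)" and ?G = "contract f e ` G"
    let ?m = "card {s \<in> {0<..1}. s *\<^sub>R e \<in> G}"
    have finB: "finite B" "j \<notin> B" "a j = e" if "B \<subseteq> A" for B
      using that insert.hyps finite_subset by (auto simp: e_def)
    \<comment> \<open>Subfamilies avoiding \<open>j\<close> form the deletion branch; those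
      containing \<open>j\<close> correspond to independent subfamilies of the contraction.\<close>
    have S_insert: "?S (insert j A) = ?S A \<union> insert j ` {B. B \<subseteq> A \<and> independent_family ?a B}"
    proof (intro equalityI subsetI)
      fix B assume B: "B \<in> ?S (insert j A)"
      show "B \<in> ?S A \<union> insert j ` {B. B \<subseteq> A \<and> independent_family ?a B}"
      proof (cases "j \<in> B")
        case True
        then have eq: "B = insert j (B - {j})" by blast
        have sub: "B - {j} \<subseteq> A"
          using B by blast
        have "independent_family ?a (B - {j})"
          using B eq independent_family_insert_iff[OF f, of _ j a, OF finB[OF sub]] by simp
        with eq sub show ?thesis by blast
      qed (use B in blast)
    next
      fix B assume "B \<in> ?S A \<union> insert j ` {B. B \<subseteq> A \<and> independent_family ?a B}"
      then show "B \<in> ?S (insert j A)"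
        using independent_family_insert_iff[OF f, of _ j a, OF finB] by auto
    qed
    have inj: "inj_on (insert j) {B. B \<subseteq> A \<and> independent_family ?a B}"
      using insert.hyps(2) by (intro inj_onI) (auto dest!: insert_ident[THEN iffD1, rotated 2])
    have "(\<Sum>B\<in>?S (insert j A). card (box_coeffs G B a)) = (\<Sum>B\<in>?S A. card (box_coeffs G B a)) +
        (\<Sum>B\<in>insert j ` {B. B \<subseteq> A \<and> independent_family ?a B}. card (box_coeffs G B a))"
      unfolding S_insert using insert.hyps by (intro sum.union_disjoint) auto
    also have "(\<Sum>B\<in>insert j ` {B. B \<subseteq> A \<and> independent_family ?a B}. card (box_coeffs G B a)) =
        (\<Sum>B | B \<subseteq> A \<and> independent_family ?a B. ?m * card (box_coeffs ?G B ?a))"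
      unfolding sum.reindex[OF inj] o_def
      using card_box_coeffs_insert[OF f G eG, of _ j a, OF finB] independent_family_insert_iff[OF f, of _ j a, OF finB]
      by (intro sum.cong) auto
    also have "\<dots> = ?m * card (zonotope A ?a \<inter> ?G)"
    proof -
      have "card (zonotope A ?a \<inter> ?G) =
          (\<Sum>B | B \<subseteq> A \<and> independent_family ?a B. card (box_coeffs ?G B ?a))"
        using insert.prems(2) by (intro insert.IH discrete_group_contract[OF f G eG]) auto
      then show ?thesis by (simp only: sum_distrib_left)
    qed
    finally show ?thesis
      using card_zonotope_insert[OF f G eG, of A j a] insert.hyps IH by (simp add: e_def)
  qed
qed

subsection \<open>Ehrhart polynomials of zonotopes\<close>

lemma independent_family_scaleR:
  assumes "finite B" "r \<noteq> 0"
  shows "independent_family (\<lambda>i. r *\<^sub>R a i) B \<longleftrightarrow> independent_family a B"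
proof -
  have "(\<Sum>i\<in>B. u i *\<^sub>R r *\<^sub>R a i) = r *\<^sub>R (\<Sum>i\<in>B. u i *\<^sub>R a i)" for u
    by (simp add: scaleR_right.sum mult.commute)
  with assms show ?thesis
    by (simp add: independent_family_iff)
qed

text \<open>Dilation by \<open>k\<close> scales every generator. In Stanley's formula each box count
  then gains a factor \<open>k ^ card B\<close>, while the unscaled count is a torsion number.
  \<open>[:0, 1:]\<close> is the polynomial indeterminate.\<close>

lemma is_ehrhart_poly_zonotope:
  fixes a :: "'i \<Rightarrow> 'v::euclidean_space"
  assumes G: "discrete_group G" and A: "finite A" "a ` A \<subseteq> G"
  shows "is_ehrhart_poly G (zonotope A a)
    (multi_ehr G A a (\<lambda>_. [:0, 1:]))"
  unfolding is_ehrhart_poly_def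
proof (intro allI impI)
  fix k :: nat assume k: "k > 0"
  have fin: "finite B" if "B \<subseteq> A" for B
    using that A(1) finite_subset by blast
  have "(\<lambda>x. real k *\<^sub>R x) ` zonotope A a = zonotope A (\<lambda>i. real k *\<^sub>R a i)"
    by (rule linear_image_zonotope) (simp add: linear_iff algebra_simps)
  moreover have "(\<lambda>i. real k *\<^sub>R a i) ` A \<subseteq> G"
    using discrete_group_scaleR[OF G, of _ "int k"] A(2) by auto
  ultimately have "card ((\<lambda>x. real k *\<^sub>R x) ` zonotope A a \<inter> G) =
      (\<Sum>B | B \<subseteq> A \<and> independent_family (\<lambda>i. real k *\<^sub>R a i) B.
        card (box_coeffs G B (\<lambda>i. real k *\<^sub>R a i)))"
    using card_zonotope_Int[OF A(1) G] by simp
  also have "\<dots> = (\<Sum>B | B \<subseteq> A \<and> independent_family a B.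
      card (quotient_torsion G (group_closure (a ` B))) * k ^ card B)"
  proof (rule sum.cong)
    show "{B. B \<subseteq> A \<and> independent_family (\<lambda>i. real k *\<^sub>R a i) B} =
        {B. B \<subseteq> A \<and> independent_family a B}"
      using k fin by (auto simp: independent_family_scaleR)
    fix B assume "B \<in> {B. B \<subseteq> A \<and> independent_family a B}"
    then have B: "finite B" "independent_family a B" "a ` B \<subseteq> G"
      using fin A(2) by auto
    then show "card (box_coeffs G B (\<lambda>i. real k *\<^sub>R a i)) =
        card (quotient_torsion G (group_closure (a ` B))) * k ^ card B"
      using k by (simp add: card_quotient_torsion[OF G] card_box_coeffs_scaleR[OF G])
  qed
  finally show "poly (multi_ehr G A a (\<lambda>_. [:0, 1:])) (real k) =
      real (card ((\<lambda>x. real k *\<^sub>R x) ` zonotope A a \<inter> G))"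
    by (simp add: multi_ehr_def poly_sum)
qed

section \<open>Values of the Ehrhart polynomials and the two identities\<close>

lemma poly_ehrhart_poly_zonotope:
  fixes a :: "'i \<Rightarrow> 'v::euclidean_space"
  assumes "discrete_group G" "finite A" "a ` A \<subseteq> G"
  shows "poly (ehrhart_poly G (zonotope A a)) t = multi_ehr G A a (\<lambda>_. t)"
  unfolding ehrhart_poly_eqI[OF is_ehrhart_poly_zonotope[OF assms]]
  by (simp add: multi_ehr_def poly_sum)

lemma poly_ehrhart_poly_unit_cube:
  assumes "finite I"
  shows "poly (ehrhart_poly (int_lattice I) (unit_cube I)) x =
    multi_ehr (int_lattice I) I std_basis (\<lambda>_. x)"
  unfolding ehrhart_poly_eqI[OF is_ehrhart_poly_unit_cube[OF assms]] multi_ehr_std_basis[OF assms]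
  by simp

theorem theorem3p19:
  fixes \<Gamma> :: "(real ^ 'n) set" and E :: "(real ^ 'n) list"
  assumes "is_lattice \<Gamma>" and "set E \<subseteq> \<Gamma>"
  shows "(\<forall>(p :: nat \<Rightarrow> 'r::comm_ring_1) (v :: nat \<Rightarrow> 'r).
            multi_ehr \<Gamma> {..<length E} ((!) E) (\<lambda>i. p i * v i) =
            (\<Sum>A\<in>Pow {..<length E}.
               (\<Prod>i\<in>A. p i) * multi_ehr \<Gamma> A ((!) E) v *
               multi_ehr (int_lattice ({..<length E} - A)) ({..<length E} - A) std_basis
                 (\<lambda>i. - p i)))
       \<and> (\<forall>(p :: real) (t :: real).
            poly (ehrhart_poly \<Gamma> (zonotope {..<length E} ((!) E))) (p * t) =
            (\<Sum>A\<in>Pow {..<length E}.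
               p ^ card A * poly (ehrhart_poly \<Gamma> (zonotope A ((!) E))) t *
               poly (ehrhart_poly (int_lattice ({..<length E} - A))
                       (unit_cube ({..<length E} - A))) (- p)))"
proof (intro conjI allI)
  fix p v :: "nat \<Rightarrow> 'r"
  show "multi_ehr \<Gamma> {..<length E} ((!) E) (\<lambda>i. p i * v i) =
            (\<Sum>A\<in>Pow {..<length E}.
               (\<Prod>i\<in>A. p i) * multi_ehr \<Gamma> A ((!) E) v *
               multi_ehr (int_lattice ({..<length E} - A)) ({..<length E} - A) std_basis
                 (\<lambda>i. - p i))"
    by (rule multi_ehr_mult) simp
next
  fix p t :: real
  have zono: "poly (ehrhart_poly \<Gamma> (zonotope A ((!) E))) x = multi_ehr \<Gamma> A ((!) E) (\<lambda>_. x)"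
    if "A \<subseteq> {..<length E}" for A x
  proof (rule poly_ehrhart_poly_zonotope)
    show "discrete_group \<Gamma>"
      using assms(1) by (rule is_lattice_discrete_group)
    show "finite A"
      using that finite_subset by blast
    show "(!) E ` A \<subseteq> \<Gamma>"
      using that assms(2) by (force simp: set_conv_nth)
  qed
  show "poly (ehrhart_poly \<Gamma> (zonotope {..<length E} ((!) E))) (p * t) =
            (\<Sum>A\<in>Pow {..<length E}.
               p ^ card A * poly (ehrhart_poly \<Gamma> (zonotope A ((!) E))) t *
               poly (ehrhart_poly (int_lattice ({..<length E} - A))
                       (unit_cube ({..<length E} - A))) (- p))"
    \<comment> \<open>For constant families the weights become powers of \<open>p\<close>, and every
      factor is the value of an Ehrhart polynomial.\<close>
    using multi_ehr_mult[of "{..<length E}" \<Gamma> "(!) E" "\<lambda>_. p" "\<lambda>_. t"]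
    by (simp add: zono poly_ehrhart_poly_unit_cube)
qed

end
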